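(* Let $w_0=[n\ n-1\ \cdots\ 2\ 1]$ be the longest element of $\mathfrak{S}_n$. Then $|\mathcal{B}(w_0)|\ge \frac{1}{2}|\mathcal{R}(w_0)|-1$.
   Context: $\mathcal{R}(\sigma)$ is the set of reduced words of $\sigma\in\mathfrak{S}_n$ (words $i_1\cdots i_l$ with $l$ the number of inversions of $\sigma$ and $\sigma=s_{i_1}\cdots s_{i_l}$, $s_i=(i\ i+1)$). A braid move replaces three adjacent letters $a(a+1)a$ of a word by $(a+1)a(a+1)$ or vice versa. Two reduced words are in the same braid class if one can be obtained from the other by a finite sequence of braid moves; $\mathcal{B}(\sigma)$ is the set of braid classes of $\mathcal{R}(\sigma)$. *)

theory Defs
  imports Complex_Main "HOL-Combinatorics.Permutations"
begin

text \<open>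
  Elements of \<open>\<SS>\<^sub>n\<close> are functions \<open>\<sigma> :: nat \<Rightarrow> nat\<close> with \<open>\<sigma> permutes {1..n}\<close>;
  words are lists of letters \<open>i \<in> {1..<n}\<close>.
\<close>

definition inversions :: "nat \<Rightarrow> (nat \<Rightarrow> nat) \<Rightarrow> (nat \<times> nat) set" where
  "inversions n \<sigma> = {(i, j). 1 \<le> i \<and> i < j \<and> j \<le> n \<and> \<sigma> i > \<sigma> j}"

definition simple_transp :: "nat \<Rightarrow> nat \<Rightarrow> nat" where
  "simple_transp i = transpose i (i + 1)"

text \<open>Products are read as composition of functions, rightmost factor applied first.\<close>

primrec word_perm :: "nat list \<Rightarrow> nat \<Rightarrow> nat" where
  "word_perm [] = id"
| "word_perm (i # w) = simple_transp i \<circ> word_perm w"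

definition reduced_words :: "nat \<Rightarrow> (nat \<Rightarrow> nat) \<Rightarrow> nat list set" where
  "reduced_words n \<sigma> =
     {w. set w \<subseteq> {1..<n} \<and> length w = card (inversions n \<sigma>) \<and> \<sigma> = word_perm w}"

inductive braid_move :: "nat list \<Rightarrow> nat list \<Rightarrow> bool" where
  up: "braid_move (u @ [a, a + 1, a] @ v) (u @ [a + 1, a, a + 1] @ v)"
| down: "braid_move (u @ [a + 1, a, a + 1] @ v) (u @ [a, a + 1, a] @ v)"

definition braid_rel :: "nat \<Rightarrow> (nat \<Rightarrow> nat) \<Rightarrow> (nat list \<times> nat list) set" where
  "braid_rel n \<sigma> =
     {(w, w'). w \<in> reduced_words n \<sigma> \<and> w' \<in> reduced_words n \<sigma> \<and> braid_move\<^sup>*\<^sup>* w w'}"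

definition braid_classes :: "nat \<Rightarrow> (nat \<Rightarrow> nat) \<Rightarrow> nat list set set" where
  "braid_classes n \<sigma> = reduced_words n \<sigma> // braid_rel n \<sigma>"

definition longest_perm :: "nat \<Rightarrow> nat \<Rightarrow> nat" where
  "longest_perm n i = (if i \<in> {1..n} then n + 1 - i else i)"

lemma longest_perm_permutes: "longest_perm n permutes {1..n}"
proof (rule bij_imp_permutes)
  show "bij_betw (longest_perm n) {1..n} {1..n}"
    by (rule bij_betw_byWitness[where f' = "longest_perm n"]) (auto simp: longest_perm_def)
qed (auto simp: longest_perm_def)

lemma finite_reduced_words: "finite (reduced_words n \<sigma>)"
  by (rule finite_subset[OF _ finite_lists_length_eq[of "{1..<n}" "card (inversions n \<sigma>)"]])
     (auto simp: reduced_words_def)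

lemma braid_move_sym: "braid_move w w' \<Longrightarrow> braid_move w' w"
  by (auto elim!: braid_move.cases intro: braid_move.intros[simplified])

lemma equiv_braid_rel: "equiv (reduced_words n \<sigma>) (braid_rel n \<sigma>)"
proof (rule equivI)
  have "symp braid_move\<^sup>*\<^sup>*"
    by (rule symp_rtranclp) (auto intro: sympI braid_move_sym)
  then show "sym (braid_rel n \<sigma>)"
    by (auto simp: sym_def braid_rel_def dest: sympD)
qed (auto simp: refl_on_def trans_def braid_rel_def)

end

theory Submission
  imports Defs
begin

text \<open>
  By a theorem of Reiner, a reduced word of the longest element admits one braid move on average.
  The graph whose edges are the braid moves therefore has half as many edges as vertices, and its
  number of components is at least the number of vertices minus the number of edges.

  Moving the first letter $i$ of a reduced word to the end as $n - i$ permutes the reduced words of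
  the longest element $w_0$, so it suffices to count those beginning with $a, a+1, a$, that is, the
  reduced words of $u_a = s_a s_{a+1} s_a w_0$. Inside the permutations of the integers, the
  Lascoux-Schuetzenberger transition formula relates $w_0$ and $u_a$ to Grassmannian permutations
  without changing the number of reduced words. For these the number is the number of standard
  Young tableaux of the corresponding shape, given by a product formula of Frobenius. The shape of
  $w_0$ is the staircase, that of $u_a$ is the staircase with a border strip of size 3 removed, and
  the resulting sum over $a$ is a Vandermonde convolution.
\<close>


section \<open>Reduced words of finitary permutations of the integers\<close>

text \<open>The integers, rather than \<open>{1..n}\<close>, remove all boundary cases from the
  transition formula. Every value \<open>w r\<close> has a neighbour above and one below, each
  standing at some position, and the terms caused by these two neighbours make the two sides agree
  exactly. In a finite symmetric group a cover may leave the group.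

  Each braid move is counted once, as an edge directed from a, a+1, a to a+1, a, a+1. An upper bound
  on the number of edges is enough, so the maps between sets of words only have to be injective.

  The convolution arises as follows. Measured from its least element, the value set of the staircase
  is {0, 2, ..., 2n-2}, and passing to u_a lowers 2a+2 to 2a-1. The quotient of the two Frobenius
  products splits at the moved element: the part above it is a coefficient of (1-x)^(-5/2), and the
  part below it, together with the quotient of the factorials, is 3 times another one. Summed over
  a, this gives 3 times a coefficient of (1-x)^(-5).\<close>

definition adj :: "int \<Rightarrow> int \<Rightarrow> int" where
  "adj k = transpose k (k + 1)"

text \<open>The letters that can begin a reduced word of \<open>w\<close>. Letters act on values,
  from the left, while the covers used later act on positions, from the right; this is why the two
  operations almost commute.\<close>

definition ldescents :: "(int \<Rightarrow> int) \<Rightarrow> int set" where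
  "ldescents w = {k. \<exists>p q. p < q \<and> w p = k + 1 \<and> w q = k}"

lemma ldescentsI: "p < q \<Longrightarrow> w p = k + 1 \<Longrightarrow> w q = k \<Longrightarrow> k \<in> ldescents w"
  by (auto simp: ldescents_def)

text \<open>Peeling off left descents turns counting into the recursion \<open>nred_rec\<close>;
  \<open>red_word_iff\<close> identifies these words with the factorizations of minimal
  length.\<close>

primrec red_word :: "int list \<Rightarrow> (int \<Rightarrow> int) \<Rightarrow> bool" where
  "red_word [] w \<longleftrightarrow> w = id"
| "red_word (k # ks) w \<longleftrightarrow> k \<in> ldescents w \<and> red_word ks (adj k \<circ> w)"

definition nred :: "(int \<Rightarrow> int) \<Rightarrow> nat" where
  "nred w = card {ks. red_word ks w}"

definition invs :: "(int \<Rightarrow> int) \<Rightarrow> (int \<times> int) set" where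
  "invs w = {(i, j). i < j \<and> w j < w i}"

definition ninv :: "(int \<Rightarrow> int) \<Rightarrow> nat" where
  "ninv w = card (invs w)"

lemma adj_simps [simp]: "adj k k = k + 1" "adj k (k + 1) = k"
  by (auto simp: adj_def)

lemma adj_other [simp]: "x \<noteq> k \<Longrightarrow> x \<noteq> k + 1 \<Longrightarrow> adj k x = x"
  by (auto simp: adj_def transpose_def)

lemma adj_apply: "adj k x = (if x = k then k + 1 else if x = k + 1 then k else x)"
  by (auto simp: adj_def transpose_def)

lemma adj_adj [simp]: "adj k \<circ> (adj k \<circ> w) = w"
  by (auto simp: fun_eq_iff adj_apply)

lemma permutation_adj_comp: "permutation w \<Longrightarrow> permutation (adj k \<circ> w)"
  by (simp add: adj_def permutation_compose permutation_swap_id)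

lemma permutation_comp_transpose: "permutation w \<Longrightarrow> permutation (w \<circ> transpose i j)"
  by (simp add: permutation_compose permutation_swap_id)

lemma permutation_eq_iff: "permutation w \<Longrightarrow> w x = w y \<longleftrightarrow> x = y"
  by (rule inj_eq[OF bij_is_inj[OF permutation_bijective]])

lemma permutation_obtain:
  assumes "permutation w" obtains x where "w x = y"
  by (metis assms bij_pointE permutation_bijective)

lemma permutation_bound:
  fixes w :: "int \<Rightarrow> int"
  assumes "permutation w"
  obtains K where "\<And>x. \<bar>x\<bar> > K \<Longrightarrow> w x = x" "\<And>x. \<bar>x\<bar> \<le> K \<Longrightarrow> \<bar>w x\<bar> \<le> K"
proof -
  have "finite {x. w x \<noteq> x}" using assms by (simp add: permutation)
  then obtain K where K: "\<And>x. w x \<noteq> x \<Longrightarrow> \<bar>x\<bar> \<le> K"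
    using Max_ge[of "abs ` {x. w x \<noteq> x}"] by (metis (mono_tags) finite_imageI imageI mem_Collect_eq)
  have 1: "w x = x" if "\<bar>x\<bar> > K" for x using K[of x] that by force
  have 2: "\<bar>w x\<bar> \<le> K" if "\<bar>x\<bar> \<le> K" for x
    using 1[of "w x"] permutation_eq_iff[OF assms, of "w x" x] that by force
  show ?thesis using that 1 2 by blast
qed

lemma finite_invs:
  assumes "permutation w" shows "finite (invs w)"
proof -
  obtain K where K: "\<And>x. \<bar>x\<bar> > K \<Longrightarrow> w x = x" "\<And>x. \<bar>x\<bar> \<le> K \<Longrightarrow> \<bar>w x\<bar> \<le> K"
    using permutation_bound[OF assms] by blast
  have "invs w \<subseteq> {-K..K} \<times> {-K..K}"
  proof (clarsimp simp: invs_def)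
    fix i j :: int assume "i < j" "w j < w i"
    moreover have "w i = i \<or> \<bar>i\<bar> \<le> K \<and> \<bar>w i\<bar> \<le> K" "w j = j \<or> \<bar>j\<bar> \<le> K \<and> \<bar>w j\<bar> \<le> K"
      using K by (meson not_le_imp_less)+
    moreover have "\<bar>i\<bar> \<le> K \<or> \<bar>i\<bar> > K" "\<bar>j\<bar> \<le> K \<or> \<bar>j\<bar> > K" by auto
    ultimately show "- K \<le> i \<and> i \<le> K \<and> - K \<le> j \<and> j \<le> K" by (smt (verit) K)
  qed
  then show ?thesis by (rule finite_subset) auto
qed

lemma finite_ldescents:
  assumes "permutation w" shows "finite (ldescents w)"
proof (rule finite_subset)
  show "ldescents w \<subseteq> (\<lambda>(p, q). w q) ` invs w"
    by (force simp: ldescents_def invs_def)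
qed (use finite_invs[OF assms] in auto)

lemma ldescents_adj_iff:
  assumes "permutation w" shows "k \<in> ldescents (adj k \<circ> w) \<longleftrightarrow> k \<notin> ldescents w"
proof -
  obtain p q where pq: "w p = k + 1" "w q = k" using permutation_obtain[OF assms] by metis
  have P: "w x = k + 1 \<longleftrightarrow> x = p" "w x = k \<longleftrightarrow> x = q" for x
    using pq permutation_eq_iff[OF assms] by metis+
  have "k \<in> ldescents w \<longleftrightarrow> p < q" unfolding ldescents_def mem_Collect_eq P by blast
  moreover have "(adj k \<circ> w) x = k + 1 \<longleftrightarrow> x = q" "(adj k \<circ> w) x = k \<longleftrightarrow> x = p" for x
    using P[of x] pq by (auto simp: adj_apply)
  then have "k \<in> ldescents (adj k \<circ> w) \<longleftrightarrow> q < p" unfolding ldescents_def mem_Collect_eq by metis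
  moreover have "p \<noteq> q" using pq by auto
  ultimately show ?thesis by auto
qed

text \<open>Exchanging two adjacent values changes the relative order of a single pair of
  positions.\<close>

lemma ninv_ldescent:
  assumes w: "permutation w" and k: "k \<in> ldescents w"
  shows "ninv w = Suc (ninv (adj k \<circ> w))"
proof -
  obtain p q where pq: "w p = k + 1" "w q = k" "p < q" using k by (auto simp: ldescents_def)
  have P: "w x = k + 1 \<longleftrightarrow> x = p" "w x = k \<longleftrightarrow> x = q" for x
    using pq permutation_eq_iff[OF w] by metis+
  have "invs w = insert (p, q) (invs (adj k \<circ> w))"
  proof -
    have "w j < w i \<longleftrightarrow> (i = p \<and> j = q) \<or> (adj k \<circ> w) j < (adj k \<circ> w) i" if "i < j" for i j
      using that P[of i] P[of j] pq by (auto simp: adj_apply)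
    then show ?thesis using pq(3) by (auto simp: invs_def)
  qed
  moreover have "(p, q) \<notin> invs (adj k \<circ> w)" using pq by (auto simp: invs_def)
  ultimately show ?thesis unfolding ninv_def
    using finite_invs[OF permutation_adj_comp[OF w]] by simp
qed

lemma ninv_adj_le:
  assumes "permutation w" shows "ninv (adj k \<circ> w) \<le> Suc (ninv w)"
proof (cases "k \<in> ldescents w")
  case True
  then show ?thesis using ninv_ldescent[OF assms] by simp
next
  case False
  then have "k \<in> ldescents (adj k \<circ> w)" using ldescents_adj_iff[OF assms] by simp
  from ninv_ldescent[OF permutation_adj_comp[OF assms] this] show ?thesis
    unfolding adj_adj by simp
qed

text \<open>The inverse \<open>g\<close> increases at every step, so \<open>g k - k\<close> is
  nondecreasing; it vanishes far out on both sides, hence everywhere.\<close>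

lemma ldescents_empty_imp_id:
  assumes w: "permutation w" and e: "ldescents w = {}" shows "w = id"
proof -
  obtain K where K: "\<And>x. \<bar>x\<bar> > K \<Longrightarrow> w x = x" "\<And>x. \<bar>x\<bar> \<le> K \<Longrightarrow> \<bar>w x\<bar> \<le> K"
    using permutation_bound[OF w] by blast
  define g where "g = inv w"
  have g: "w (g x) = x" for x
    unfolding g_def using w by (simp add: bij_is_surj permutation_bijective surj_f_inv_f)
  have gK: "g x = x" if "\<bar>x\<bar> > K" for x
    using K(1)[OF that] g[of x] permutation_eq_iff[OF w] by metis
  have step: "g k - k \<le> g (k + 1) - (k + 1)" for k
  proof -
    have "\<not> g (k + 1) < g k" using e g unfolding ldescents_def by blast
    moreover have "g (k + 1) \<noteq> g k" using g by (metis less_add_one order_less_irrefl)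
    ultimately show ?thesis by linarith
  qed
  have mono: "g a - a \<le> g b - b" if "a \<le> b" for a b
    using that by (induction b rule: int_ge_induct) (use step order_trans in \<open>auto, force\<close>)
  have "g x = x" for x
  proof -
    define M where "M = \<bar>x\<bar> + \<bar>K\<bar> + 1"
    have "g (-M) - (-M) \<le> g x - x" "g x - x \<le> g M - M"
      by (rule mono, simp add: M_def)+
    moreover have "g M = M" "g (-M) = -M" by (rule gK, simp add: M_def)+
    ultimately show ?thesis by linarith
  qed
  then show ?thesis using g by (metis eq_id_iff)
qed

lemma ldescents_id [simp]: "ldescents id = {}"
  by (auto simp: ldescents_def)

lemma red_words_id: "{ks. red_word ks id} = {[]}"
proof -
  have "red_word ks id \<longleftrightarrow> ks = []" for ks by (cases ks) auto
  then show ?thesis by auto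
qed

lemma red_words_unfold:
  assumes "w \<noteq> id"
  shows "{ks. red_word ks w} = (\<Union>k\<in>ldescents w. (#) k ` {ks. red_word ks (adj k \<circ> w)})"
proof -
  have "red_word ks w \<longleftrightarrow> (\<exists>k\<in>ldescents w. \<exists>l. red_word l (adj k \<circ> w) \<and> ks = k # l)" for ks
    using assms by (cases ks) auto
  then show ?thesis by auto
qed

lemma finite_red_words:
  assumes "permutation w" shows "finite {ks. red_word ks w}"
  using assms
proof (induction "ninv w" arbitrary: w rule: less_induct)
  case less
  show ?case
  proof (cases "w = id")
    case False
    have "finite {ks. red_word ks (adj k \<circ> w)}" if "k \<in> ldescents w" for k
      using less ninv_ldescent[OF less.prems that] permutation_adj_comp by auto
    then show ?thesis
      unfolding red_words_unfold[OF False] using finite_ldescents[OF less.prems] by blast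
  qed (simp add: red_words_id)
qed

lemma nred_id: "nred id = 1"
  by (simp add: nred_def red_words_id)

lemma nred_rec:
  assumes w: "permutation w" and "w \<noteq> id"
  shows "nred w = (\<Sum>k\<in>ldescents w. nred (adj k \<circ> w))"
proof -
  have "nred w = (\<Sum>k\<in>ldescents w. card ((#) k ` {ks. red_word ks (adj k \<circ> w)}))"
    unfolding nred_def red_words_unfold[OF assms(2)]
    by (rule card_UN_disjoint)
       (use finite_ldescents[OF w] finite_red_words[OF permutation_adj_comp[OF w]] in \<open>blast+\<close>)
  also have "\<dots> = (\<Sum>k\<in>ldescents w. nred (adj k \<circ> w))"
    unfolding nred_def by (intro sum.cong refl card_image) auto
  finally show ?thesis .
qed

section \<open>Reduced words as factorizations of minimal length\<close>

primrec word_prod :: "int list \<Rightarrow> int \<Rightarrow> int" where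
  "word_prod [] = id"
| "word_prod (k # ks) = adj k \<circ> word_prod ks"

lemma permutation_word_prod: "permutation (word_prod ks)"
proof (induction ks)
  case (Cons k ks)
  then show ?case using permutation_adj_comp by (simp only: word_prod.simps)
qed simp

lemma ninv_word_prod_le: "ninv (word_prod ks) \<le> length ks"
proof (induction ks)
  case Nil
  have "invs id = {}" by (auto simp: invs_def)
  then show ?case unfolding word_prod.simps by (metis card.empty list.size(3) ninv_def order_refl)
next
  case (Cons k ks)
  then show ?case using ninv_adj_le[OF permutation_word_prod, of k ks]
    unfolding word_prod.simps list.size by linarith
qed

lemma red_word_iff:
  assumes "permutation w"
  shows "red_word ks w \<longleftrightarrow> word_prod ks = w \<and> length ks = ninv w"
  using assms
proof (induction ks arbitrary: w)
  case Nil
  have "invs id = {}" by (auto simp: invs_def)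
  then show ?case unfolding red_word.simps word_prod.simps by (metis card.empty list.size(3) ninv_def)
next
  case (Cons k ks)
  have perm: "permutation (adj k \<circ> w)" using Cons.prems by (rule permutation_adj_comp)
  note IH = Cons.IH[OF perm]
  let ?P = "word_prod ks"
  have eq: "adj k \<circ> ?P = w \<longleftrightarrow> ?P = adj k \<circ> w" using adj_adj[of k] by metis
  show ?case
  proof
    assume "red_word (k # ks) w"
    then show "word_prod (k # ks) = w \<and> length (k # ks) = ninv w"
      using IH ninv_ldescent[OF Cons.prems, of k] eq by (simp del: o_apply)
  next
    assume R: "word_prod (k # ks) = w \<and> length (k # ks) = ninv w"
    then have P: "?P = adj k \<circ> w" using eq by simp
    have le: "ninv (adj k \<circ> w) \<le> length ks" using ninv_word_prod_le[of ks] P by simp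
    have k: "k \<in> ldescents w"
    \<comment> \<open>Otherwise \<open>adj k \<circ> w\<close> has more inversions than
      \<open>w\<close>, yet it is the product of \<open>ks\<close>, which has one letter fewer than
      \<open>w\<close> has inversions.\<close>
    proof (rule ccontr)
      assume "k \<notin> ldescents w"
      then have "ninv (adj k \<circ> w) = Suc (ninv w)"
        using ninv_ldescent[OF perm, of k] ldescents_adj_iff[OF Cons.prems, of k]
        unfolding adj_adj by blast
      then show False using le R by simp
    qed
    moreover have "length ks = ninv (adj k \<circ> w)" using R ninv_ldescent[OF Cons.prems k] by simp
    ultimately show "red_word (k # ks) w" using IH P unfolding red_word.simps by blast
  qed
qed

section \<open>The transition formula\<close>

text \<open>These are the covers of \<open>w\<close> in Bruhat order: the transposition of positions
  \<open>i\<close> and \<open>j\<close> creates exactly one new inversion.\<close>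

definition covers :: "(int \<Rightarrow> int) \<Rightarrow> (int \<times> int) set" where
  "covers w = {(i, j). i < j \<and> w i < w j \<and> (\<forall>m. i < m \<and> m < j \<longrightarrow> \<not> (w i < w m \<and> w m < w j))}"

text \<open>Let \<open>p\<close> and \<open>q\<close> be the positions of \<open>k + 1\<close> and
  \<open>k\<close>; at most one of them is \<open>i\<close> or \<open>j\<close>. If none is, nothing
  interacts. If one is, the cover conditions for \<open>w\<close> and for
  \<open>adj k \<circ> w\<close> differ only in whether the other one lies strictly between
  \<open>i\<close> and \<open>j\<close>, and exactly this decides whether \<open>k\<close> is a left
  descent both before and after the exchange of positions.\<close>

lemma covers_ldescents_commute:
  assumes w: "permutation w" and ns: "\<not> (w i \<in> {k, k + 1} \<and> w j \<in> {k, k + 1})"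
  shows "(i, j) \<in> covers w \<and> k \<in> ldescents (w \<circ> transpose i j) \<longleftrightarrow>
         k \<in> ldescents w \<and> (i, j) \<in> covers (adj k \<circ> w)"
proof (cases "i < j")
  case False
  then show ?thesis by (auto simp: covers_def)
next
  case ij: True
  obtain p q where pq: "w p = k + 1" "w q = k" using permutation_obtain[OF w] by metis
  have P: "w x = k + 1 \<longleftrightarrow> x = p" "w x = k \<longleftrightarrow> x = q" for x
    using pq permutation_eq_iff[OF w] by metis+
  have d: "k \<in> ldescents w \<longleftrightarrow> p < q" unfolding ldescents_def mem_Collect_eq P by simp
  have "(w \<circ> transpose i j) x = k + 1 \<longleftrightarrow> x = transpose i j p"
       "(w \<circ> transpose i j) x = k \<longleftrightarrow> x = transpose i j q" for x
    unfolding o_apply P by (metis transpose_involutory)+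
  then have dt: "k \<in> ldescents (w \<circ> transpose i j) \<longleftrightarrow> transpose i j p < transpose i j q"
    unfolding ldescents_def mem_Collect_eq by metis
  have neq: "p \<noteq> q" using pq by auto
  have nij: "\<not> (i \<in> {p, q} \<and> j \<in> {p, q})" using ns pq by auto
  have adj: "adj k (w x) = (if x = p then k else if x = q then k + 1 else w x)" for x
    using P[of x] by (auto simp: adj_apply)
  have far: "w x < k \<or> w x > k + 1" if "x \<noteq> p" "x \<noteq> q" for x
    using P[of x] that by linarith
  consider "i \<notin> {p, q}" "j \<notin> {p, q}" | "i = p" "j \<notin> {p, q}" | "i = q" "j \<notin> {p, q}"
    | "j = p" "i \<notin> {p, q}" | "j = q" "i \<notin> {p, q}" using nij by auto
  then show ?thesis
  proof cases
    case 1
    then have t: "transpose i j p = p" "transpose i j q = q" by (auto simp: transpose_def)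
    have "adj k (w m) < w j \<longleftrightarrow> w m < w j" "w i < adj k (w m) \<longleftrightarrow> w i < w m" for m
      using far[of i] far[of j] 1 pq by (auto simp: adj)
    moreover have "adj k (w i) = w i" "adj k (w j) = w j" using 1 by (auto simp: adj)
    ultimately have "(i, j) \<in> covers (adj k \<circ> w) \<longleftrightarrow> (i, j) \<in> covers w"
      by (simp add: covers_def)
    then show ?thesis using t d dt by auto
  next
    case 2
    then have t: "transpose i j p = j" "transpose i j q = q" using neq by (auto simp: transpose_def)
    have a: "adj k (w i) = k" "adj k (w j) = w j" using 2 neq by (auto simp: adj)
    have "adj k (w m) < w j \<longleftrightarrow> w m < w j" for m
      using far[of j] 2 pq by (auto simp: adj)
    moreover have "k < adj k (w m) \<longleftrightarrow> w i < w m \<or> m = q" for m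
      using far[of m] 2 pq neq by (auto simp: adj)
    moreover have "w i < w j \<longleftrightarrow> k < w j" using far[of j] 2 pq by auto
    ultimately have "(i, j) \<in> covers (adj k \<circ> w) \<longleftrightarrow> (i, j) \<in> covers w \<and> \<not> (i < q \<and> q < j)"
      unfolding covers_def using a pq far[of j] 2 by auto
    then show ?thesis unfolding d dt t using 2 ij neq by auto
  next
    case 3
    then have t: "transpose i j p = p" "transpose i j q = j" using neq by (auto simp: transpose_def)
    have a: "adj k (w i) = k + 1" "adj k (w j) = w j" using 3 neq by (auto simp: adj)
    have "adj k (w m) < w j \<longleftrightarrow> w m < w j" for m
      using far[of j] 3 pq by (auto simp: adj)
    moreover have "w i < w m \<longleftrightarrow> k + 1 < adj k (w m) \<or> m = p" for m
      using far[of m] 3 pq neq by (auto simp: adj)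
    moreover have "w i < w j \<longleftrightarrow> k + 1 < w j" using far[of j] 3 pq by auto
    ultimately have "(i, j) \<in> covers w \<longleftrightarrow> (i, j) \<in> covers (adj k \<circ> w) \<and> \<not> (i < p \<and> p < j)"
      unfolding covers_def using a pq far[of j] 3 by auto
    then show ?thesis unfolding d dt t using 3 ij neq by auto
  next
    case 4
    then have t: "transpose i j p = i" "transpose i j q = q" using neq by (auto simp: transpose_def)
    have a: "adj k (w j) = k" "adj k (w i) = w i" using 4 neq by (auto simp: adj)
    have "w i < adj k (w m) \<longleftrightarrow> w i < w m" for m
      using far[of i] 4 pq by (auto simp: adj)
    moreover have "w m < w j \<longleftrightarrow> adj k (w m) < k \<or> m = q" for m
      using far[of m] 4 pq neq by (auto simp: adj)
    moreover have "w i < w j \<longleftrightarrow> w i < k" using far[of i] 4 pq by auto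
    ultimately have "(i, j) \<in> covers w \<longleftrightarrow> (i, j) \<in> covers (adj k \<circ> w) \<and> \<not> (i < q \<and> q < j)"
      unfolding covers_def using a pq far[of i] 4 by auto
    then show ?thesis unfolding d dt t using 4 ij neq by auto
  next
    case 5
    then have t: "transpose i j p = p" "transpose i j q = i" using neq by (auto simp: transpose_def)
    have a: "adj k (w j) = k + 1" "adj k (w i) = w i" using 5 neq by (auto simp: adj)
    have "w i < adj k (w m) \<longleftrightarrow> w i < w m" for m
      using far[of i] 5 pq by (auto simp: adj)
    moreover have "adj k (w m) < k + 1 \<longleftrightarrow> w m < w j \<or> m = p" for m
      using far[of m] 5 pq neq by (auto simp: adj)
    moreover have "w i < w j \<longleftrightarrow> w i < k + 1" using far[of i] 5 pq by auto
    ultimately have "(i, j) \<in> covers (adj k \<circ> w) \<longleftrightarrow> (i, j) \<in> covers w \<and> \<not> (i < p \<and> p < j)"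
      unfolding covers_def using a pq far[of i] 5 by auto
    then show ?thesis unfolding d dt t using 5 ij neq by auto
  qed
qed

lemma adj_comp_transpose:
  assumes "permutation w" "w i \<in> {k, k + 1}" "w j \<in> {k, k + 1}" "i \<noteq> j"
  shows "adj k \<circ> (w \<circ> transpose i j) = w"
proof
  fix x
  have "w i \<noteq> w j" using assms permutation_eq_iff by metis
  moreover have "w x \<noteq> w i" "w x \<noteq> w j" if "x \<noteq> i" "x \<noteq> j"
    using that assms(1) permutation_eq_iff by metis+
  ultimately show "(adj k \<circ> (w \<circ> transpose i j)) x = w x"
    using assms(2,3) by (cases "x = i"; cases "x = j") (auto simp: adj_apply transpose_def)
qed

text \<open>Deleting a left descent commutes with passing to a cover, except where the two
  values exchanged by the cover are adjacent.\<close>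

lemma sum_covers_rec:
  assumes w: "permutation w"
    and fin: "\<And>v. permutation v \<Longrightarrow> finite (T \<inter> covers v)"
  shows "(\<Sum>(i, j)\<in>T \<inter> covers w. nred (w \<circ> transpose i j))
           + nred w * card {(i, j). (i, j) \<in> T \<and> i < j \<and> w i = w j + 1} =
         (\<Sum>k\<in>ldescents w. \<Sum>(i, j)\<in>T \<inter> covers (adj k \<circ> w). nred (adj k \<circ> w \<circ> transpose i j))
           + nred w * card {(i, j). (i, j) \<in> T \<and> i < j \<and> w j = w i + 1}"
proof -
  \<comment> \<open>\<open>X\<close> collects "pass to a cover, then delete a descent" and
    \<open>Y\<close> "delete a descent, then pass to a cover". They agree outside \<open>S\<close>;
    inside \<open>S\<close> the two operations undo each other, so each pair there contributes
    \<open>nred w\<close>.\<close>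
  define S where "S = {((i, j), k). w i \<in> {k, k + 1} \<and> w j \<in> {k, k + 1}}"
  define X where "X = (SIGMA e:T \<inter> covers w. ldescents (w \<circ> transpose (fst e) (snd e)))"
  define Y where "Y = {(e, k). k \<in> ldescents w \<and> e \<in> T \<inter> covers (adj k \<circ> w)}"
  define g where "g = (\<lambda>(e, k). nred (adj k \<circ> (w \<circ> transpose (fst e) (snd e))))"
  have perm: "permutation (w \<circ> transpose i j)" "permutation (adj k \<circ> w)" for i j k
    using w by (auto intro: permutation_comp_transpose permutation_adj_comp)
  have finX: "finite X" unfolding X_def
    using fin[OF w] finite_ldescents[OF perm(1)] by blast
  have Yeq: "Y = prod.swap ` (SIGMA k:ldescents w. T \<inter> covers (adj k \<circ> w))"
    unfolding Y_def by (auto simp: image_iff)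
  have finY: "finite Y" unfolding Yeq
    using finite_ldescents[OF w] fin[OF perm(2)] by blast
  have LX: "(\<Sum>(i, j)\<in>T \<inter> covers w. nred (w \<circ> transpose i j)) = sum g X"
  proof -
    have "nred (w \<circ> transpose i j) =
          (\<Sum>k\<in>ldescents (w \<circ> transpose i j). nred (adj k \<circ> (w \<circ> transpose i j)))"
      if "(i, j) \<in> covers w" for i j
    proof (rule nred_rec[OF perm(1)])
      have "(w \<circ> transpose i j) j < (w \<circ> transpose i j) i" "i < j"
        using that by (auto simp: covers_def)
      then show "w \<circ> transpose i j \<noteq> id" by (metis id_apply not_less_iff_gr_or_eq)
    qed
    then have "(\<Sum>(i, j)\<in>T \<inter> covers w. nred (w \<circ> transpose i j)) =
       (\<Sum>e\<in>T \<inter> covers w. \<Sum>k\<in>ldescents (w \<circ> transpose (fst e) (snd e)). g (e, k))"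
      by (intro sum.cong) (auto simp: g_def)
    also have "\<dots> = sum g X"
      unfolding X_def by (subst sum.Sigma) (use fin[OF w] finite_ldescents[OF perm(1)] in \<open>auto simp: case_prod_beta\<close>)
    finally show ?thesis .
  qed
  have LY: "(\<Sum>k\<in>ldescents w. \<Sum>(i, j)\<in>T \<inter> covers (adj k \<circ> w). nred (adj k \<circ> w \<circ> transpose i j)) = sum g Y"
  proof -
    have "(\<Sum>k\<in>ldescents w. \<Sum>(i, j)\<in>T \<inter> covers (adj k \<circ> w). nred (adj k \<circ> w \<circ> transpose i j)) =
       (\<Sum>k\<in>ldescents w. \<Sum>e\<in>T \<inter> covers (adj k \<circ> w). g (e, k))"
      by (intro sum.cong) (auto simp: g_def comp_assoc)
    also have "\<dots> = (\<Sum>(k, e)\<in>(SIGMA k:ldescents w. T \<inter> covers (adj k \<circ> w)). g (e, k))"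
      by (rule sum.Sigma) (use finite_ldescents[OF w] fin[OF perm(2)] in auto)
    also have "\<dots> = sum g Y"
      unfolding Yeq by (subst sum.reindex) (auto simp: case_prod_beta prod.swap_def)
    finally show ?thesis .
  qed
  have XY: "X - S = Y - S"
  proof (intro set_eqI)
    fix z :: "(int \<times> int) \<times> int"
    obtain i j k where z: "z = ((i, j), k)" by (cases z) auto
    show "z \<in> X - S \<longleftrightarrow> z \<in> Y - S"
    proof (cases "z \<in> S")
      case False
      then have "\<not> (w i \<in> {k, k + 1} \<and> w j \<in> {k, k + 1})" by (auto simp: z S_def)
      from covers_ldescents_commute[OF w this] show ?thesis
        using False by (auto simp: z X_def Y_def)
    qed auto
  qed
  have XS: "sum g (X \<inter> S) = nred w * card {(i, j). (i, j) \<in> T \<and> i < j \<and> w j = w i + 1}" (is "_ = _ * card ?A")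
  proof -
    have "X \<inter> S = (\<lambda>(i, j). ((i, j), w i)) ` ?A"
    proof (intro equalityI subsetI)
      fix z assume "z \<in> X \<inter> S"
      then show "z \<in> (\<lambda>(i, j). ((i, j), w i)) ` ?A"
        by (auto simp: X_def S_def covers_def image_iff)
    next
      fix z assume "z \<in> (\<lambda>(i, j). ((i, j), w i)) ` ?A"
      then obtain i j where z: "z = ((i, j), w i)" "(i, j) \<in> T" "i < j" "w j = w i + 1" by auto
      have "w i \<in> ldescents (w \<circ> transpose i j)"
        unfolding ldescents_def using z by (intro CollectI exI[of _ i] exI[of _ j]) auto
      then show "z \<in> X \<inter> S" using z by (auto simp: X_def S_def covers_def)
    qed
    then have "sum g (X \<inter> S) = (\<Sum>(i, j)\<in>?A. g ((i, j), w i))"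
      by (simp add: sum.reindex inj_on_def case_prod_beta)
    also have "\<dots> = (\<Sum>(i, j)\<in>?A. nred w)"
      using adj_comp_transpose[OF w] by (intro sum.cong refl) (auto simp: g_def)
    finally show ?thesis by (simp add: case_prod_beta)
  qed
  have YS: "sum g (Y \<inter> S) = nred w * card {(i, j). (i, j) \<in> T \<and> i < j \<and> w i = w j + 1}" (is "_ = _ * card ?A")
  proof -
    have "Y \<inter> S = (\<lambda>(i, j). ((i, j), w j)) ` ?A"
    proof (intro equalityI subsetI)
      fix z assume "z \<in> Y \<inter> S"
      then show "z \<in> (\<lambda>(i, j). ((i, j), w j)) ` ?A"
        by (auto simp: Y_def S_def covers_def image_iff)
    next
      fix z assume "z \<in> (\<lambda>(i, j). ((i, j), w j)) ` ?A"
      then obtain i j where z: "z = ((i, j), w j)" "(i, j) \<in> T" "i < j" "w i = w j + 1" by auto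
      have "w j \<in> ldescents w"
        unfolding ldescents_def using z by (intro CollectI exI[of _ i] exI[of _ j]) auto
      then show "z \<in> Y \<inter> S" using z by (auto simp: Y_def S_def covers_def)
    qed
    then have "sum g (Y \<inter> S) = (\<Sum>(i, j)\<in>?A. g ((i, j), w j))"
      by (simp add: sum.reindex inj_on_def case_prod_beta)
    also have "\<dots> = (\<Sum>(i, j)\<in>?A. nred w)"
      using adj_comp_transpose[OF w] by (intro sum.cong refl) (auto simp: g_def)
    finally show ?thesis by (simp add: case_prod_beta)
  qed
  have "sum g X = sum g (X \<inter> S) + sum g (X - S)" "sum g Y = sum g (Y \<inter> S) + sum g (Y - S)"
    using sum.Int_Diff[OF finX, of g S] sum.Int_Diff[OF finY, of g S] by auto
  then show ?thesis unfolding LX LY using XY XS YS by simp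
qed

text \<open>Far out, \<open>w\<close> fixes both \<open>j\<close> and \<open>j - 1\<close>, and the
  value at \<open>j - 1\<close> blocks the cover; symmetrically with \<open>i + 1\<close> on the
  left. Hence both sums in the transition formula are finite.\<close>

lemma covers_bound:
  assumes K: "\<And>x. \<bar>x\<bar> > K \<Longrightarrow> w x = x" and w: "permutation w" and c: "(i, j) \<in> covers w"
  shows "j \<le> \<bar>K\<bar> + \<bar>i\<bar> + 1" "i \<ge> - (\<bar>K\<bar> + \<bar>j\<bar> + 1)"
proof -
  have ij: "i < j" "w i < w j" "\<And>m. i < m \<Longrightarrow> m < j \<Longrightarrow> \<not> (w i < w m \<and> w m < w j)"
    using c by (auto simp: covers_def)
  show "j \<le> \<bar>K\<bar> + \<bar>i\<bar> + 1"
  proof (rule ccontr)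
    assume "\<not> ?thesis"
    then have "w j = j" "w (j - 1) = j - 1" "i < j - 1" using K[of j] K[of "j - 1"] by auto
    moreover have "w i \<noteq> w (j - 1)" using permutation_eq_iff[OF w] \<open>i < j - 1\<close> by simp
    ultimately show False using ij(3)[of "j - 1"] ij(2) by linarith
  qed
  show "i \<ge> - (\<bar>K\<bar> + \<bar>j\<bar> + 1)"
  proof (rule ccontr)
    assume "\<not> ?thesis"
    then have "w i = i" "w (i + 1) = i + 1" "i + 1 < j" using K[of i] K[of "i + 1"] by auto
    moreover have "w j \<noteq> w (i + 1)" using permutation_eq_iff[OF w] \<open>i + 1 < j\<close> by simp
    ultimately show False using ij(3)[of "i + 1"] ij(2) by linarith
  qed
qed

lemma finite_covers_from:
  assumes "permutation w" shows "finite (({r} \<times> UNIV) \<inter> covers w)"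
proof -
  obtain K where K: "\<And>x. \<bar>x\<bar> > K \<Longrightarrow> w x = x" using permutation_bound[OF assms] by metis
  have "({r} \<times> UNIV) \<inter> covers w \<subseteq> {r} \<times> {r..\<bar>K\<bar> + \<bar>r\<bar> + 1}"
    using covers_bound(1)[OF K assms] by (auto simp: covers_def)
  then show ?thesis by (rule finite_subset) auto
qed

lemma finite_covers_to:
  assumes "permutation w" shows "finite ((UNIV \<times> {r}) \<inter> covers w)"
proof -
  obtain K where K: "\<And>x. \<bar>x\<bar> > K \<Longrightarrow> w x = x" using permutation_bound[OF assms] by metis
  have "(UNIV \<times> {r}) \<inter> covers w \<subseteq> {- (\<bar>K\<bar> + \<bar>r\<bar> + 1)..r} \<times> {r}"
    using covers_bound(2)[OF K assms] by (auto simp: covers_def)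
  then show ?thesis by (rule finite_subset) auto
qed

text \<open>By \<open>sum_covers_rec\<close> both sides satisfy the same recursion over left
  descents, up to multiples of \<open>nred w\<close> that depend on the positions \<open>s\<close>
  and \<open>t\<close> of the values next to \<open>w r\<close>. The multiples are [r < s] - [r < t]
  on one side and [t < r] - [s < r] on the other, which are equal because \<open>s\<close> and
  \<open>t\<close> differ from \<open>r\<close>. The identity needs no separate base case, as its
  sum over descents is empty.\<close>

lemma transition:
  assumes "permutation w"
  shows "(\<Sum>(i, j)\<in>({r} \<times> UNIV) \<inter> covers w. nred (w \<circ> transpose i j)) =
         (\<Sum>(i, j)\<in>(UNIV \<times> {r}) \<inter> covers w. nred (w \<circ> transpose i j))"
  using assms
proof (induction "ninv w" arbitrary: w rule: less_induct)
  case less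
  note w = less.prems
  obtain s t where s: "w s = w r + 1" and t: "w r = w t + 1"
    using permutation_obtain[OF w] by (metis diff_add_cancel)
  have "w x = w r + 1 \<longleftrightarrow> x = s" "w r = w x + 1 \<longleftrightarrow> x = t" for x
    using s t permutation_eq_iff[OF w] by (smt (verit, best))+
  then have sets:
    "{(i, j). (i, j) \<in> {r} \<times> UNIV \<and> i < j \<and> w i = w j + 1} = (if r < t then {(r, t)} else {})"
    "{(i, j). (i, j) \<in> {r} \<times> UNIV \<and> i < j \<and> w j = w i + 1} = (if r < s then {(r, s)} else {})"
    "{(i, j). (i, j) \<in> UNIV \<times> {r} \<and> i < j \<and> w i = w j + 1} = (if s < r then {(s, r)} else {})"
    "{(i, j). (i, j) \<in> UNIV \<times> {r} \<and> i < j \<and> w j = w i + 1} = (if t < r then {(t, r)} else {})"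
    by auto
  have "s \<noteq> r" "t \<noteq> r" using s t by auto
  moreover have "(\<Sum>k\<in>ldescents w. \<Sum>(i, j)\<in>({r} \<times> UNIV) \<inter> covers (adj k \<circ> w). nred (adj k \<circ> w \<circ> transpose i j)) =
     (\<Sum>k\<in>ldescents w. \<Sum>(i, j)\<in>(UNIV \<times> {r}) \<inter> covers (adj k \<circ> w). nred (adj k \<circ> w \<circ> transpose i j))"
    by (intro sum.cong refl less.hyps permutation_adj_comp[OF w]) (use ninv_ldescent[OF w] in simp)
  moreover note sum_covers_rec[OF w finite_covers_from, of r] sum_covers_rec[OF w finite_covers_to, of r]
  ultimately show ?case unfolding sets by (cases "s < r"; cases "t < r") auto
qed

section \<open>Grassmannian permutations\<close>

definition vdm :: "int set \<Rightarrow> real" where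
  "vdm L = (\<Prod>x\<in>L. \<Prod>y\<in>{y \<in> L. y < x}. real_of_int (x - y))"

text \<open>Up to sign, the residue at \<open>x\<close> of the product of all 1 - 1/(z - y); also
  the factor by which the Vandermonde product changes when \<open>x\<close> is lowered to a vacant
  \<open>x - 1\<close>.\<close>

definition pfc :: "int set \<Rightarrow> int \<Rightarrow> real" where
  "pfc L x = (\<Prod>y\<in>L - {x}. 1 - 1 / real_of_int (x - y))"

lemma vdm_pos: "finite L \<Longrightarrow> vdm L > 0"
  by (auto simp: vdm_def intro!: prod_pos)

lemma vdm_insert:
  assumes "finite L" "z \<notin> L"
  shows "vdm (insert z L) = vdm L * (\<Prod>y\<in>L. \<bar>real_of_int (z - y)\<bar>)"
proof -
  have 1: "(\<Prod>y\<in>{y \<in> insert z L. y < x}. real_of_int (x - y)) =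
     (if z < x then real_of_int (x - z) else 1) * (\<Prod>y\<in>{y \<in> L. y < x}. real_of_int (x - y))" for x
  proof -
    have "{y \<in> insert z L. y < x} = (if z < x then insert z {y \<in> L. y < x} else {y \<in> L. y < x})" by auto
    then show ?thesis using assms by simp
  qed
  have 2: "(\<Prod>y\<in>{y \<in> L. y < z}. real_of_int (z - y)) = (\<Prod>y\<in>L. if y < z then real_of_int (z - y) else 1)"
    using assms by (simp add: prod.inter_filter del: of_int_diff)
  have "vdm (insert z L) = (\<Prod>y\<in>L. if y < z then real_of_int (z - y) else 1) *
      (\<Prod>x\<in>L. if z < x then real_of_int (x - z) else 1) * vdm L"
    unfolding vdm_def prod.insert[OF assms] 1 2 prod.distrib by simp
  also have "(\<Prod>y\<in>L. if y < z then real_of_int (z - y) else 1) *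
      (\<Prod>x\<in>L. if z < x then real_of_int (x - z) else 1) = (\<Prod>y\<in>L. \<bar>real_of_int (z - y)\<bar>)"
    unfolding prod.distrib[symmetric] using assms by (intro prod.cong) auto
  finally show ?thesis by simp
qed

lemma vdm_move:
  assumes "finite L" "x \<in> L" "z \<notin> L"
  shows "vdm (insert z (L - {x})) =
         vdm L * (\<Prod>y\<in>L - {x}. \<bar>real_of_int (z - y)\<bar> / \<bar>real_of_int (x - y)\<bar>)"
proof -
  have "vdm L = vdm (L - {x}) * (\<Prod>y\<in>L - {x}. \<bar>real_of_int (x - y)\<bar>)"
    using vdm_insert[of "L - {x}" x] assms by (simp add: insert_absorb)
  moreover have "(\<Prod>y\<in>L - {x}. \<bar>real_of_int (x - y)\<bar>) \<noteq> 0" using assms by auto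
  moreover have "vdm (insert z (L - {x})) = vdm (L - {x}) * (\<Prod>y\<in>L - {x}. \<bar>real_of_int (z - y)\<bar>)"
    using vdm_insert[of "L - {x}" z] assms by simp
  ultimately show ?thesis by (simp add: prod_dividef)
qed

lemma pfc_insert:
  assumes "finite L" "u \<notin> L"
  shows "x \<in> L \<Longrightarrow> pfc (insert u L) x = pfc L x * (1 - 1 / real_of_int (x - u))"
    and "pfc (insert u L) u = (\<Prod>y\<in>L. 1 - 1 / real_of_int (u - y))"
proof -
  show "pfc (insert u L) x = pfc L x * (1 - 1 / real_of_int (x - u))" if "x \<in> L"
  proof -
    have "insert u L - {x} = insert u (L - {x})" using that assms by auto
    then show ?thesis using assms by (simp add: pfc_def mult.commute)
  qed
  show "pfc (insert u L) u = (\<Prod>y\<in>L. 1 - 1 / real_of_int (u - y))"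
    using assms by (simp add: pfc_def)
qed

text \<open>The induction keeps \<open>z\<close> general because its hypothesis is used twice: at
  \<open>z\<close>, and at the new pole \<open>u\<close>, where it evaluates the coefficient
  belonging to \<open>u\<close>.\<close>

lemma partial_fractions:
  assumes "finite L" "z \<notin> L"
  shows "(\<Prod>y\<in>L. 1 - 1 / real_of_int (z - y)) = 1 - (\<Sum>x\<in>L. pfc L x / real_of_int (z - x))"
  using assms
proof (induction L arbitrary: z rule: finite_induct)
  case (insert u L)
  have zu: "z \<noteq> u" "z \<notin> L" using insert.prems by auto
  have summand: "pfc L x * (1 - 1 / real_of_int (x - u)) / real_of_int (z - x)
       - pfc L x / real_of_int (u - x) / real_of_int (z - u)
      = pfc L x / real_of_int (z - x) * (1 - 1 / real_of_int (z - u))" if "x \<in> L" for x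
  proof -
    have nz: "real_of_int x \<noteq> real_of_int u" "real_of_int z \<noteq> real_of_int x" "real_of_int z \<noteq> real_of_int u"
      using that insert.hyps(2) zu by auto
    show ?thesis using nz by (simp add: divide_simps) (simp add: algebra_simps)
  qed
  have "(\<Sum>x\<in>insert u L. pfc (insert u L) x / real_of_int (z - x)) =
      (1 - (\<Sum>x\<in>L. pfc L x / real_of_int (u - x))) / real_of_int (z - u)
      + (\<Sum>x\<in>L. pfc L x * (1 - 1 / real_of_int (x - u)) / real_of_int (z - x))"
    using insert.hyps insert.IH[of u] pfc_insert[OF insert.hyps] by simp
  also have "\<dots> = 1 / real_of_int (z - u) + (\<Sum>x\<in>L. pfc L x / real_of_int (z - x)) * (1 - 1 / real_of_int (z - u))"
    unfolding sum_distrib_right diff_divide_distrib sum_divide_distrib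
    using sum.cong[OF refl summand, of L id, simplified]
    by (simp add: sum_subtractf diff_divide_distrib sum_distrib_right)
  finally have *: "(\<Sum>x\<in>insert u L. pfc (insert u L) x / real_of_int (z - x)) = \<dots>" .
  have "(\<Prod>y\<in>insert u L. 1 - 1 / real_of_int (z - y)) =
     (1 - 1 / real_of_int (z - u)) * (1 - (\<Sum>x\<in>L. pfc L x / real_of_int (z - x)))"
    using insert.hyps insert.IH[OF zu(2)] by simp
  then show ?case unfolding * by (simp add: algebra_simps)
qed simp

text \<open>Comparison of the coefficients of 1/z in \<open>partial_fractions\<close>, carried out
  by induction instead of a limit.\<close>

lemma sum_pfc: "finite L \<Longrightarrow> (\<Sum>x\<in>L. pfc L x) = real (card L)"
proof (induction L rule: finite_induct)
  case (insert u L)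
  have "(\<Sum>x\<in>L. pfc L x * (1 - 1 / real_of_int (x - u))) = (\<Sum>x\<in>L. pfc L x + pfc L x / real_of_int (u - x))"
  proof (rule sum.cong)
    fix x assume "x \<in> L"
    then have "real_of_int x \<noteq> real_of_int u" using insert.hyps by auto
    then show "pfc L x * (1 - 1 / real_of_int (x - u)) = pfc L x + pfc L x / real_of_int (u - x)"
      by (simp add: divide_simps) (simp add: algebra_simps)
  qed simp
  then show ?case
    using insert pfc_insert[OF insert.hyps] partial_fractions[OF insert.hyps] by (simp add: sum.distrib)
qed simp

text \<open>Comparison of the coefficients of 1/z^2, with the origin moved to \<open>b\<close>. The
  right-hand side is the number of boxes of the partition encoded by \<open>L\<close>, so this is
  the branching rule for standard Young tableaux divided by common factors.\<close>

lemma sum_weighted_pfc: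
  "finite L \<Longrightarrow> (\<Sum>x\<in>L. real_of_int (x - b) * pfc L x) =
     (\<Sum>x\<in>L. real_of_int (x - b)) - real (card L) * (real (card L) - 1) / 2"
proof (induction L rule: finite_induct)
  case (insert u L)
  let ?k = "real (card L)"
  have "(\<Sum>x\<in>L. real_of_int (x - b) * (pfc L x * (1 - 1 / real_of_int (x - u)))) =
      (\<Sum>x\<in>L. real_of_int (x - b) * pfc L x - pfc L x + real_of_int (u - b) * (pfc L x / real_of_int (u - x)))"
  proof (rule sum.cong)
    fix x assume "x \<in> L"
    then have "real_of_int x \<noteq> real_of_int u" using insert.hyps by auto
    then show "real_of_int (x - b) * (pfc L x * (1 - 1 / real_of_int (x - u))) =
      real_of_int (x - b) * pfc L x - pfc L x + real_of_int (u - b) * (pfc L x / real_of_int (u - x))"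
      by (simp add: divide_simps) (simp add: algebra_simps)
  qed simp
  also have "\<dots> = (\<Sum>x\<in>L. real_of_int (x - b) * pfc L x) - ?k
       + real_of_int (u - b) * (\<Sum>x\<in>L. pfc L x / real_of_int (u - x))"
    unfolding sum_distrib_left using sum_pfc[OF insert.hyps(1)]
    by (simp add: sum.distrib sum_subtractf)
  finally have 1: "(\<Sum>x\<in>L. real_of_int (x - b) * pfc (insert u L) x) = \<dots>"
    using pfc_insert(1)[OF insert.hyps] by simp
  have "(\<Sum>x\<in>insert u L. real_of_int (x - b) * pfc (insert u L) x) =
     (\<Sum>x\<in>L. real_of_int (x - b) * pfc L x) - ?k + real_of_int (u - b)"
  proof -
    have "(\<Sum>x\<in>insert u L. real_of_int (x - b) * pfc (insert u L) x) = real_of_int (u - b) *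
       (1 - (\<Sum>x\<in>L. pfc L x / real_of_int (u - x))) + (\<Sum>x\<in>L. real_of_int (x - b) * pfc (insert u L) x)"
      using insert.hyps pfc_insert(2)[OF insert.hyps] partial_fractions[OF insert.hyps] by simp
    then show ?thesis unfolding 1 right_diff_distrib by simp
  qed
  then show ?case using insert by (simp add: field_simps)
qed simp

text \<open>The differences \<open>x - b\<close> are the beta numbers of a partition; multiplied by
  the factorial of its size, this is the Frobenius count of its standard Young tableaux.\<close>

definition frob :: "int \<Rightarrow> int set \<Rightarrow> real" where
  "frob b L = vdm L / (\<Prod>x\<in>L. fact (nat (x - b)))"

lemma frob_move:
  assumes "finite L" "x \<in> L" "z \<notin> L"
  shows "frob b (insert z (L - {x})) = frob b L * (fact (nat (x - b)) / fact (nat (z - b)))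
         * (\<Prod>y\<in>L - {x}. \<bar>real_of_int (z - y)\<bar> / \<bar>real_of_int (x - y)\<bar>)"
proof -
  have "(\<Prod>x\<in>L. fact (nat (x - b))) = fact (nat (x - b)) * (\<Prod>x\<in>L - {x}. fact (nat (x - b)) :: real)"
    using assms by (simp add: prod.remove)
  then show ?thesis using vdm_move[OF assms] assms by (simp add: frob_def field_simps)
qed

text \<open>Removal of one box. As \<open>x - 1\<close> is vacant, x - y and x - 1 - y never have
  opposite signs for the other \<open>y\<close>, so the absolute values in \<open>frob_move\<close>
  disappear.\<close>

lemma frob_move_down:
  assumes "finite L" "x \<in> L" "b \<le> x - 1" "x - 1 \<notin> L"
  shows "frob b (insert (x - 1) (L - {x})) = frob b L * (real_of_int (x - b) * pfc L x)"
proof -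
  have "(fact (nat (x - b)) :: real) = real_of_int (x - b) * fact (nat (x - 1 - b))"
  proof -
    have "nat (x - b) = Suc (nat (x - 1 - b))" using assms(3) by auto
    moreover have "real (Suc (nat (x - 1 - b))) = real_of_int (x - b)" using assms(3) by simp
    ultimately show ?thesis by (metis fact_Suc)
  qed
  moreover have "(\<Prod>y\<in>L - {x}. \<bar>real_of_int (x - 1 - y)\<bar> / \<bar>real_of_int (x - y)\<bar>) = pfc L x"
    unfolding pfc_def
  proof (rule prod.cong)
    fix y assume "y \<in> L - {x}"
    then consider "x - y \<ge> 1" | "x - y \<le> - 1" by fastforce
    then have "\<bar>real_of_int (x - 1 - y)\<bar> / \<bar>real_of_int (x - y)\<bar> = real_of_int (x - 1 - y) / real_of_int (x - y)"
    proof cases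
      case 2
      then have "real_of_int (x - 1 - y) < 0" "real_of_int (x - y) < 0" by (simp_all only: of_int_less_0_iff)
      then show ?thesis by (simp only: abs_of_neg minus_divide_divide)
    qed (simp add: abs_if)
    moreover have "real_of_int (x - y) \<noteq> 0" using \<open>y \<in> L - {x}\<close> by auto
    ultimately show "\<bar>real_of_int (x - 1 - y)\<bar> / \<bar>real_of_int (x - y)\<bar> = 1 - 1 / real_of_int (x - y)"
      by (simp add: field_simps)
  qed simp
  ultimately show ?thesis using frob_move[OF assms(1,2,4), of b] by simp
qed

text \<open>An interval starting at \<open>b\<close> encodes the empty partition, the base of the
  induction on boxes.\<close>

lemma frob_interval: "frob b {b..<b + int n} = 1"
proof (induction n)
  case (Suc n)
  have "{b..<b + int (Suc n)} = insert (b + int n) {b..<b + int n}" by auto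
  moreover have "(\<Prod>y\<in>{b..<b + int n}. \<bar>real_of_int (b + int n - y)\<bar>) = fact n"
  proof -
    have "(\<Prod>y\<in>{b..<b + int n}. \<bar>real_of_int (b + int n - y)\<bar>) = (\<Prod>i\<in>{1..n}. real i)"
      by (rule prod.reindex_bij_witness[where i = "\<lambda>i. b + int n - int i" and j = "\<lambda>y. nat (b + int n - y)"]) auto
    then show ?thesis by (simp add: fact_prod)
  qed
  ultimately show ?case using Suc vdm_insert[of "{b..<b + int n}" "b + int n"]
    vdm_pos[of "{b..<b + int n}"] by (simp add: frob_def)
qed (simp add: frob_def vdm_def)

lemma sum_interval: "(\<Sum>x\<in>{b..<b + int n}. real_of_int (x - b)) = real n * (real n - 1) / 2"
proof (induction n)
  case (Suc n)
  have "{b..<b + int (Suc n)} = insert (b + int n) {b..<b + int n}" by auto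
  then show ?case using Suc by (simp add: field_simps)
qed simp

text \<open>The value set on the left encodes a partition; this is the Frobenius formula for the number of
  standard Young tableaux of that shape.\<close>

lemma nred_grassmannian:
  assumes "permutation w" "strict_mono_on {..<p} w" "strict_mono_on {p..} w"
    and "{..<b} \<subseteq> w ` {..<p}" "L = w ` {..<p} \<inter> {b..}"
  shows "finite L" "real (ninv w) = (\<Sum>x\<in>L. real_of_int (x - b)) - real (card L) * (real (card L) - 1) / 2"
    "real (nred w) = fact (ninv w) * frob b L"
proof -
  have "finite L \<and> real (ninv w) = (\<Sum>x\<in>L. real_of_int (x - b)) - real (card L) * (real (card L) - 1) / 2
     \<and> real (nred w) = fact (ninv w) * frob b L"
    using assms
  proof (induction "ninv w" arbitrary: w L rule: less_induct)
    case less
    note w = less.prems(1) and A = less.prems(2) and B = less.prems(3) and b = less.prems(4) and L = less.prems(5)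
    show ?case
    proof (cases "w = id")
      case True
      then have bp: "b \<le> p" using b by auto
      define n where "n = nat (p - b)"
      have "L = {b..<b + int n}" using L True bp by (auto simp: n_def)
      moreover have "invs w = {}" using True by (auto simp: invs_def)
      then have "ninv w = 0" by (simp add: ninv_def)
      ultimately show ?thesis
        using True frob_interval[of b n] sum_interval[of b n] by (simp add: nred_id)
    next
      case False
      have inj: "w x = w y \<longleftrightarrow> x = y" for x y using permutation_eq_iff[OF w] .
      \<comment> \<open>Left descents are the removable boxes: elements of \<open>L\<close> above
        \<open>b\<close> whose predecessor is vacant.\<close>
      have desc: "k \<in> ldescents w \<longleftrightarrow> k + 1 \<in> L \<and> k \<notin> L \<and> b \<le> k" for k
      proof
        assume "k \<in> ldescents w"
        then obtain i j where ij: "i < j" "w i = k + 1" "w j = k" by (auto simp: ldescents_def)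
        have "i < p" "p \<le> j"
          using ij strict_mono_onD[OF A, of i j] strict_mono_onD[OF B, of i j] by force+
        then have "j \<notin> {..<p}" "i \<in> {..<p}" by auto
        then have "k \<notin> w ` {..<p}" "k + 1 \<in> w ` {..<p}"
          using ij inj by (metis imageE, metis imageI)
        moreover from this have "b \<le> k" using b by (meson lessThan_iff not_less subsetD)
        ultimately show "k + 1 \<in> L \<and> k \<notin> L \<and> b \<le> k" using L by auto
      next
        assume k: "k + 1 \<in> L \<and> k \<notin> L \<and> b \<le> k"
        then obtain i where i: "w i = k + 1" "i < p" using L by auto
        obtain j where j: "w j = k" using permutation_obtain[OF w] .
        then have "\<not> j < p" using k L by auto
        then show "k \<in> ldescents w" using i j by (intro ldescentsI[of i j]) auto
      qed
      \<comment> \<open>The induction hypothesis for any single removable box already yields the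
        finiteness of \<open>L\<close> and its size, so they are carried along with the
        count.\<close>
      have step: "finite L \<and>
         real (ninv w) = (\<Sum>x\<in>L. real_of_int (x - b)) - real (card L) * (real (card L) - 1) / 2 \<and>
         real (nred (adj k \<circ> w)) = fact (ninv w - 1) * (frob b L * (real_of_int (k + 1 - b) * pfc L (k + 1)))"
        if k: "k \<in> ldescents w" for k
      proof -
        let ?v = "adj k \<circ> w" and ?L = "insert k (L - {k + 1})"
        have kL: "k + 1 \<in> L" "k \<notin> L" "b \<le> k" using desc k by auto
        then obtain i where i: "w i = k + 1" "i < p" using L by auto
        obtain j where j: "w j = k" using permutation_obtain[OF w] .
        have jp: "\<not> j < p" using j kL L by auto
        have v: "?v x = (if x = i then k else if x = j then k + 1 else w x)" for x
          using inj[of x i] inj[of x j] i j by (auto simp: adj_apply)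
        have far: "w x < k \<or> k + 1 < w x" if "x \<noteq> i" "x \<noteq> j" for x
          using inj[of x i] inj[of x j] i j that by linarith
        have A': "strict_mono_on {..<p} ?v"
        proof (rule strict_mono_onI)
          fix r s assume "r \<in> {..<p}" "s \<in> {..<p}" "r < s"
          moreover from this have "w r < w s" using strict_mono_onD[OF A] by blast
          ultimately show "?v r < ?v s" unfolding v using jp far[of r] far[of s] i(1) by (auto split: if_splits)
        qed
        have B': "strict_mono_on {p..} ?v"
        proof (rule strict_mono_onI)
          fix r s assume "r \<in> {p..}" "s \<in> {p..}" "r < s"
          moreover from this have "w r < w s" using strict_mono_onD[OF B] by blast
          ultimately show "?v r < ?v s" unfolding v using i far[of r] far[of s] j by (auto split: if_splits)
        qed
        have img: "?v ` {..<p} = insert k (w ` {..<p} - {k + 1})"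
        proof -
          have "?v ` {..<p} = ?v ` insert i ({..<p} - {i})" using i by (simp add: insert_absorb)
          also have "\<dots> = insert k (?v ` ({..<p} - {i}))" using v[of i] by (simp only: image_insert if_True refl)
          also have "?v ` ({..<p} - {i}) = w ` ({..<p} - {i})" by (rule image_cong) (use jp v in auto)
          also have "\<dots> = w ` {..<p} - {k + 1}" using i inj[of _ i] by auto
          finally show ?thesis .
        qed
        have nv: "ninv w = Suc (ninv ?v)" using ninv_ldescent[OF w k] .
        have IH: "finite ?L \<and> real (ninv ?v) = (\<Sum>x\<in>?L. real_of_int (x - b)) - real (card ?L) * (real (card ?L) - 1) / 2
            \<and> real (nred ?v) = fact (ninv ?v) * frob b ?L"
        proof (rule less.hyps)
          show "ninv ?v < ninv w" using nv by simp
          show "permutation ?v" using permutation_adj_comp[OF w] .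
          show "{..<b} \<subseteq> ?v ` {..<p}" unfolding img using b kL by auto
          show "?L = ?v ` {..<p} \<inter> {b..}" unfolding img using L kL by auto
        qed (fact A' B')+
        then have fin: "finite L" by simp
        have card: "card ?L = card L" using fin kL by (simp add: card_Diff_singleton) (metis Suc_pred card_gt_0_iff empty_iff)
        have "(\<Sum>x\<in>?L. real_of_int (x - b)) = (\<Sum>x\<in>L. real_of_int (x - b)) - 1"
          using fin kL by (simp add: sum_diff1)
        moreover have "frob b ?L = frob b L * (real_of_int (k + 1 - b) * pfc L (k + 1))"
          using frob_move_down[OF fin kL(1)] kL by simp
        ultimately show ?thesis using IH fin nv unfolding card by simp
      qed
      obtain k where k: "k \<in> ldescents w" using ldescents_empty_imp_id[OF w] False by blast
      have fin: "finite L" and nv: "real (ninv w) = (\<Sum>x\<in>L. real_of_int (x - b)) - real (card L) * (real (card L) - 1) / 2"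
        using step[OF k] by auto
      \<comment> \<open>Elements that give no removable box contribute 0: either the weight vanishes
        at \<open>b\<close>, or \<open>pfc L x\<close> contains the factor 1 - 1/1 from
        \<open>x - 1\<close>. The recursion over descents thus extends to a sum over all of
        \<open>L\<close>.\<close>
      have zero: "real_of_int (x - b) * pfc L x = 0" if "x \<in> L" "x - 1 \<notin> ldescents w" for x
      proof (cases "x = b")
        case False
        then have "b \<le> x - 1" using that L by auto
        then have "x - 1 \<in> L" using that desc[of "x - 1"] by auto
        then have "pfc L x = 0" unfolding pfc_def using fin by (intro prod_zero bexI[of _ "x - 1"]) auto
        then show ?thesis by simp
      qed simp
      have "real (nred w) = (\<Sum>k\<in>ldescents w. fact (ninv w - 1) * (frob b L * (real_of_int (k + 1 - b) * pfc L (k + 1))))"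
        using nred_rec[OF w False] step by simp
      also have "\<dots> = (\<Sum>x\<in>(\<lambda>k. k + 1) ` ldescents w. fact (ninv w - 1) * (frob b L * (real_of_int (x - b) * pfc L x)))"
        by (simp add: sum.reindex)
      also have "\<dots> = (\<Sum>x\<in>L. fact (ninv w - 1) * (frob b L * (real_of_int (x - b) * pfc L x)))"
      proof (rule sum.mono_neutral_left[OF fin])
        show "(\<lambda>k. k + 1) ` ldescents w \<subseteq> L" using desc by auto
        show "\<forall>i\<in>L - (\<lambda>k. k + 1) ` ldescents w. fact (ninv w - 1) * (frob b L * (real_of_int (i - b) * pfc L i)) = 0"
        proof
          fix x assume x: "x \<in> L - (\<lambda>k. k + 1) ` ldescents w"
          then have "x - 1 \<notin> ldescents w" by force
          then show "fact (ninv w - 1) * (frob b L * (real_of_int (x - b) * pfc L x)) = 0"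
            using zero[of x] x by auto
        qed
      qed
      also have "\<dots> = fact (ninv w - 1) * frob b L * real (ninv w)"
        unfolding nv sum_weighted_pfc[OF fin, symmetric] by (simp add: sum_distrib_left mult.assoc)
      also have "\<dots> = fact (ninv w) * frob b L"
        using ninv_ldescent[OF w k] by (simp add: fact_reduce)
      finally show ?thesis using fin nv by blast
    qed
  qed
  then show "finite L" "real (ninv w) = (\<Sum>x\<in>L. real_of_int (x - b)) - real (card L) * (real (card L) - 1) / 2"
    "real (nred w) = fact (ninv w) * frob b L" by auto
qed

section \<open>Reduction to Grassmannian permutations\<close>

text \<open>Apply \<open>transition\<close> at \<open>r\<close> to the permutation \<open>v\<close>
  in which \<open>w r\<close> and \<open>w s\<close> are exchanged. The gap conditions and the large
  middle values leave one cover on each side: \<open>(r, s)\<close>, which leads back to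
  \<open>w\<close>, and \<open>(i, r)\<close>, which leads to \<open>w'\<close>.\<close>

lemma transition_step:
  assumes w: "permutation w" and A: "strict_mono_on {..<p} w" and B: "strict_mono_on {r<..} w"
    and pr: "p \<le> r" and s: "r < s" "w s < w r" and gapB: "\<And>j. r < j \<Longrightarrow> \<not> (w s < w j \<and> w j < w r)"
    and i: "i < p" "w i < w s" and gapA: "\<And>m. m < p \<Longrightarrow> \<not> (w i < w m \<and> w m < w s)"
    and M: "\<And>m. p \<le> m \<Longrightarrow> m < r \<Longrightarrow> w s < w m"
    and w': "w' = w(r := w i, s := w r, i := w s)"
  shows "permutation w'" "strict_mono_on {..<p} w'" "strict_mono_on {r<..} w'" "nred w' = nred w"
proof -
  have inj: "w x = w y \<longleftrightarrow> x = y" for x y using permutation_eq_iff[OF w] .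
  have ir: "i < r" using i pr by simp
  define v where "v = w \<circ> transpose r s"
  have v: "permutation v" unfolding v_def using permutation_comp_transpose[OF w] .
  have vx: "v x = (if x = r then w s else if x = s then w r else w x)" for x
    by (simp add: v_def transpose_def)
  have w'v: "w' = v \<circ> transpose i r"
    using ir s by (auto simp: fun_eq_iff w' vx transpose_def)
  have wv: "w = v \<circ> transpose r s" by (simp add: v_def comp_assoc)
  show "permutation w'" unfolding w'v using permutation_comp_transpose[OF v] .
  have "({r} \<times> UNIV) \<inter> covers v = {(r, s)}"
  proof (intro equalityI subsetI)
    fix z assume "z \<in> ({r} \<times> UNIV) \<inter> covers v"
    then obtain j where z: "z = (r, j)" and j: "r < j" "v r < v j"
      and c: "\<And>m. r < m \<Longrightarrow> m < j \<Longrightarrow> \<not> (v r < v m \<and> v m < v j)" by (auto simp: covers_def)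
    have "j = s"
    proof (rule ccontr)
      assume ne: "j \<noteq> s"
      then have "w s < w j" using j vx by auto
      moreover have "w j \<noteq> w r" using inj j by simp
      ultimately have rj: "w r < w j" using gapB[OF j(1)] by linarith
      show False
      proof (cases "s < j")
        case True
        then show False using c[of s] s rj ne j by (auto simp: vx)
      next
        case False
        then have "w j < w s" using strict_mono_onD[OF B, of j s] j ne by simp
        then show False using \<open>w s < w j\<close> by simp
      qed
    qed
    then show "z \<in> {(r, s)}" using z by simp
  next
    fix z assume "z \<in> {(r, s)}"
    moreover have "\<not> (w s < w m)" if "r < m" "m < s" for m
      using strict_mono_onD[OF B, of m s] that by simp
    ultimately show "z \<in> ({r} \<times> UNIV) \<inter> covers v"
      using s by (auto simp: covers_def vx)
  qed
  moreover have "(UNIV \<times> {r}) \<inter> covers v = {(i, r)}"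
  proof (intro equalityI subsetI)
    fix z assume "z \<in> (UNIV \<times> {r}) \<inter> covers v"
    then obtain m where z: "z = (m, r)" and m: "m < r" "v m < v r"
      and c: "\<And>l. m < l \<Longrightarrow> l < r \<Longrightarrow> \<not> (v m < v l \<and> v l < v r)" by (auto simp: covers_def)
    have wm: "w m < w s" using m s by (auto simp: vx split: if_splits)
    have mp: "m < p" using M[of m] m wm by linarith
    have "m = i"
    proof (rule ccontr)
      assume ne: "m \<noteq> i"
      then have "w m < w i" using gapA[OF mp] wm inj[of m i] by linarith
      then have "m < i" using strict_mono_onD[OF A, of i m] ne mp i by force
      then show False using c[OF _ ir] \<open>w m < w i\<close> i m ir s by (auto simp: vx)
    qed
    then show "z \<in> {(i, r)}" using z by simp
  next
    fix z assume "z \<in> {(i, r)}"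
    moreover have "\<not> (w i < w m \<and> w m < w s)" if "m < r" for m
      using gapA[of m] M[of m] that by force
    ultimately show "z \<in> (UNIV \<times> {r}) \<inter> covers v"
      using s i ir by (auto simp: covers_def vx)
  qed
  ultimately show "nred w' = nred w"
    using transition[OF v, of r] by (simp add: w'v wv[symmetric])
  show "strict_mono_on {..<p} w'"
  proof (rule strict_mono_onI)
    fix x y assume xy: "x \<in> {..<p}" "y \<in> {..<p}" "x < y"
    then have l: "w x < w y" using strict_mono_onD[OF A] by blast
    have "w x \<noteq> w s" "w y \<noteq> w s" using inj xy pr s by auto
    then show "w' x < w' y" using xy pr s i l gapA[of y] gapA[of x] by (auto simp: w')
  qed
  show "strict_mono_on {r<..} w'"
  proof (rule strict_mono_onI)
    fix x y assume xy: "x \<in> {r<..}" "y \<in> {r<..}" "x < y"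
    then have l: "w x < w y" using strict_mono_onD[OF B] by blast
    have "w x \<noteq> w r" "w y \<noteq> w r" using inj xy by auto
    then show "w' x < w' y" using xy ir s l gapB[of y] gapB[of x] by (auto simp: w')
  qed
qed

text \<open>A single position with value x, standing to the left of an increasing block with value
  set B, is absorbed into the block by repeated transitions: x replaces the largest smaller b in B,
  b replaces the largest smaller value a to the left of the position, and a is absorbed next.\<close>

inductive bump :: "int set \<Rightarrow> int \<Rightarrow> int set \<Rightarrow> bool" where
  stop: "B \<inter> {..<x} = {} \<Longrightarrow> bump B x (insert x B)"
| step: "b \<in> B \<Longrightarrow> b < x \<Longrightarrow> B \<inter> {b<..<x} = {} \<Longrightarrow> a \<notin> B \<Longrightarrow> a < b \<Longrightarrow> {a<..<b} \<subseteq> B \<Longrightarrow>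
    bump (insert x (B - {b})) a B' \<Longrightarrow> bump B x B'"

text \<open>The last hypothesis protects the positions still waiting between \<open>p\<close> and
  \<open>r\<close>: their values exceed every \<open>b\<close> that gets displaced, hence also the
  \<open>a\<close> below it. So \<open>a\<close> stands to the left of \<open>p\<close>, and the
  hypothesis survives each step because the absorbed value only decreases.\<close>

lemma bump_nred:
  assumes "bump B x B'" and "permutation w" "strict_mono_on {..<p} w" "strict_mono_on {r<..} w"
    "p \<le> r" "w ` {r<..} = B" "w r = x" "\<And>m b. p \<le> m \<Longrightarrow> m < r \<Longrightarrow> b \<in> B \<Longrightarrow> b < x \<Longrightarrow> b < w m"
  shows "\<exists>w'. permutation w' \<and> strict_mono_on {..<p} w' \<and> strict_mono_on {r - 1<..} w' \<and>
    w' ` {r - 1<..} = B' \<and> (\<forall>m. p \<le> m \<and> m < r \<longrightarrow> w' m = w m) \<and> nred w' = nred w"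
  using assms
proof (induction arbitrary: w rule: bump.induct)
  case (stop B x)
  have eq: "{r - 1<..} = insert r {r<..}" by auto
  have "strict_mono_on {r - 1<..} w"
  proof (rule strict_mono_onI)
    fix m n assume mn: "m \<in> {r - 1<..}" "n \<in> {r - 1<..}" "m < n"
    show "w m < w n"
    proof (cases "m = r")
      case True
      then have "w n \<in> B" using stop.prems(5) mn by auto
      then have "x \<le> w n" using stop.hyps by force
      moreover have "w n \<noteq> w r" using permutation_eq_iff[OF stop.prems(1)] mn True by simp
      ultimately show ?thesis using True stop.prems(6) by simp
    next
      case False
      then show ?thesis using strict_mono_onD[OF stop.prems(3), of m n] mn by simp
    qed
  qed
  then show ?case using stop.prems unfolding eq by (intro exI[of _ w]) auto
next
  case (step b B x a B')
  note w = step.prems(1) and img = step.prems(5) and M = step.prems(7)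
  have inj: "w y = w z \<longleftrightarrow> y = z" for y z using permutation_eq_iff[OF w] .
  obtain s where s: "r < s" "w s = b" using step.hyps(1) img by auto
  obtain i where i: "w i = a" using permutation_obtain[OF w] .
  have ip: "i < p"
  proof (rule ccontr)
    assume "\<not> i < p"
    then consider "p \<le> i" "i < r" | "i = r" | "r < i" by linarith
    then show False
    proof cases
      case 1 then show False using M[of i b] step.hyps i by auto
    next
      case 2 then show False using i step by auto
    next
      case 3 then show False using i step img by auto
    qed
  qed
  define w' where "w' = w(r := w i, s := w r, i := w s)"
  have bx: "w s < w r" "w i < w s" using s i step.hyps(2,5) step.prems(6) by simp_all
  have gapB: "\<not> (w s < w j \<and> w j < w r)" if "r < j" for j
  proof -
    have "w j \<in> B" using img that by auto
    then have "w j \<notin> {b<..<x}" using step.hyps(3) by auto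
    then show ?thesis using s step.prems(6) by auto
  qed
  have gapA: "\<not> (w i < w m \<and> w m < w s)" if "m < p" for m
  proof
    assume "w i < w m \<and> w m < w s"
    then have "w m \<in> B" using step.hyps(6) i s by auto
    then obtain j where "r < j" "w j = w m" using img by force
    then show False using inj[of j m] that step.prems(4) by simp
  qed
  have big: "w s < w m" if "p \<le> m" "m < r" for m
    using M[OF that, of b] step.hyps(1,2) s by simp
  note w' = transition_step[OF w step.prems(2,3,4) s(1) bx(1) gapB ip bx(2) gapA big w'_def]
  have i_r: "i < r" using ip step.prems(4) by simp
  have img': "w' ` {r<..} = insert x (B - {b})"
  proof -
    have "w' ` {r<..} = w' ` insert s ({r<..} - {s})" using s by (simp add: insert_absorb)
    also have "\<dots> = insert (w' s) (w' ` ({r<..} - {s}))" by (rule image_insert)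
    also have "w' s = w r" using s i_r by (simp add: w'_def)
    also have "w' ` ({r<..} - {s}) = w ` ({r<..} - {s})"
      by (rule image_cong) (use i_r in \<open>auto simp: w'_def\<close>)
    also have "\<dots> = B - {b}" using img[symmetric] s inj[of _ s] by auto
    finally show ?thesis using step.prems(6) by simp
  qed
  have same: "w' m = w m" if "p \<le> m" "m < r" for m using that ip s by (auto simp: w'_def)
  have "\<exists>w''. permutation w'' \<and> strict_mono_on {..<p} w'' \<and> strict_mono_on {r - 1<..} w'' \<and>
    w'' ` {r - 1<..} = B' \<and> (\<forall>m. p \<le> m \<and> m < r \<longrightarrow> w'' m = w' m) \<and> nred w'' = nred w'"
  proof (rule step.IH[OF w'(1-3) step.prems(4) img'])
    show "w' r = a" using i i_r s by (simp add: w'_def)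
    show "b' < w' m" if "p \<le> m" "m < r" "b' \<in> insert x (B - {b})" "b' < a" for m b'
      using M[OF that(1,2), of b'] same[OF that(1,2)] that step.hyps by auto
  qed
  then show ?case using w'(4) same by auto
qed

text \<open>The state once all positions beyond \<open>r\<close> have been absorbed. Both outer
  blocks being increasing, the permutation is determined by \<open>B\<close> and the values of
  \<open>v\<close> in between.\<close>

definition absorbed :: "(int \<Rightarrow> int) \<Rightarrow> int \<Rightarrow> int set \<Rightarrow> bool" where
  "absorbed v r B \<longleftrightarrow> (\<exists>w. permutation w \<and> strict_mono_on {..<1} w \<and> strict_mono_on {r<..} w \<and>
     w ` {r<..} = B \<and> (\<forall>m. 1 \<le> m \<and> m \<le> r \<longrightarrow> w m = v m) \<and> nred w = nred v)"

lemma absorbed_step: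
  assumes "absorbed v r B" "1 \<le> r" "bump B (v r) B'"
    and "\<And>m b. 1 \<le> m \<Longrightarrow> m < r \<Longrightarrow> b \<in> B \<Longrightarrow> b < v r \<Longrightarrow> b < v m"
  shows "absorbed v (r - 1) B'"
proof -
  obtain w where w: "permutation w" "strict_mono_on {..<1} w" "strict_mono_on {r<..} w" "w ` {r<..} = B"
    "\<And>m. 1 \<le> m \<Longrightarrow> m \<le> r \<Longrightarrow> w m = v m" "nred w = nred v"
    using assms(1) unfolding absorbed_def by blast
  obtain w' where "permutation w'" "strict_mono_on {..<1} w'" "strict_mono_on {r - 1<..} w'"
    "w' ` {r - 1<..} = B'" "\<And>m. 1 \<le> m \<Longrightarrow> m < r \<Longrightarrow> w' m = w m" "nred w' = nred w"
    using bump_nred[OF assms(3) w(1-3) assms(2) w(4)] w(5) assms(2,4) by (metis (no_types, lifting) order_less_imp_le order_refl)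
  then show ?thesis using w(5,6) unfolding absorbed_def by (intro exI[of _ w']) auto
qed

text \<open>At \<open>r = 0\<close> nothing is left between the two blocks, so the left one has
  value set \<open>- B\<close> and the Frobenius formula applies.\<close>

lemma nred_absorbed:
  assumes "absorbed v 0 B" "B \<inter> {..<b} = {}" "L = {b..} - B"
  obtains N where "finite L"
    "real N = (\<Sum>x\<in>L. real_of_int (x - b)) - real (card L) * (real (card L) - 1) / 2"
    "real (nred v) = fact N * frob b L"
proof -
  obtain w where w: "permutation w" "strict_mono_on {..<1} w" "strict_mono_on {0<..} w" "w ` {0<..} = B"
    "nred w = nred v"
    using assms(1) unfolding absorbed_def by blast
  have 1: "{0<..} = {1::int..}" by auto
  have "w ` {..<1} = - B"
  proof -
    have "{..<1::int} = - {0<..}" by auto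
    then show ?thesis using bij_image_Compl_eq[OF permutation_bijective[OF w(1)], of "{0<..}"] w(4) by simp
  qed
  then have "{..<b} \<subseteq> w ` {..<1}" "L = w ` {..<1} \<inter> {b..}" using assms(2,3) by auto
  from nred_grassmannian[OF w(1,2) w(3)[unfolded 1] this] show ?thesis
    using that[of "ninv w"] w(5) by simp
qed

section \<open>Absorption into staircase value sets\<close>

definition down :: "int \<Rightarrow> nat \<Rightarrow> int set" where
  "down y m = (\<lambda>j. y - 2 * int j) ` {..<m}"

lemma in_down_iff: "z \<in> down y m \<longleftrightarrow> z \<le> y \<and> y < z + 2 * int m \<and> even (y - z)"
proof
  assume R: "z \<le> y \<and> y < z + 2 * int m \<and> even (y - z)"
  then obtain k where "y - z = 2 * k" by blast
  then have "z = y - 2 * int (nat k)" "nat k < m" using R by auto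
  then show "z \<in> down y m" unfolding down_def by blast
qed (auto simp: down_def)

lemma down_0 [simp]: "down y 0 = {}"
  by (simp add: down_def)

lemma down_Suc: "down y (Suc m) = insert y (down (y - 2) m)"
  by (auto simp: in_down_iff; presburger)

text \<open>Every displaced \<open>b\<close> finds its predecessor vacant, so the replacement chain
  runs through the whole progression and shifts it down by one. The bound \<open>y\<close> is
  separate from \<open>x\<close> since the gap below the first inserted value may be longer than
  later ones.\<close>

lemma bump_alternating:
  assumes "\<And>z. z < x \<Longrightarrow> z \<in> B \<longleftrightarrow> z \<in> down (y - 1) m" "y \<le> x"
  shows "bump B x (insert x (B \<inter> {x..}) \<union> down (y - 2) m)"
  using assms
proof (induction m arbitrary: B x y)
  case 0
  then have "B \<inter> {..<x} = {}" by auto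
  moreover have "B \<inter> {x..} = B" using 0 by force
  ultimately show ?case using bump.stop by simp
next
  case (Suc m)
  have low: "z \<in> B \<longleftrightarrow> z = y - 1 \<or> z \<in> down (y - 3) m" if "z < x" for z
    using Suc.prems(1)[OF that] by (simp add: down_Suc)
  have gap: "z \<notin> B" if "y \<le> z" "z < x" for z
    using low[OF that(2)] that by (auto simp: in_down_iff)
  let ?B = "insert x (B - {y - 1})"
  have "bump ?B (y - 2) (insert (y - 2) (?B \<inter> {y - 2..}) \<union> down (y - 2 - 2) m)"
  proof (rule Suc.IH)
    fix z assume "z < y - 2"
    then show "z \<in> ?B \<longleftrightarrow> z \<in> down (y - 2 - 1) m"
      using low[of z] Suc.prems(2) by auto
  qed simp
  moreover have "insert (y - 2) (?B \<inter> {y - 2..}) \<union> down (y - 2 - 2) m =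
      insert x (B \<inter> {x..}) \<union> down (y - 2) (Suc m)"
  proof -
    have "?B \<inter> {y - 2..} - {y - 2} = insert x (B \<inter> {x..}) - {y - 2}"
    proof (intro set_eqI)
      fix z
      consider "z \<le> y - 2" | "z = y - 1" | "y \<le> z" "z < x" | "x \<le> z" by linarith
      then show "z \<in> ?B \<inter> {y - 2..} - {y - 2} \<longleftrightarrow> z \<in> insert x (B \<inter> {x..}) - {y - 2}"
        using gap[of z] Suc.prems(2) by cases auto
    qed
    then show ?thesis unfolding down_Suc by auto
  qed
  ultimately have "bump ?B (y - 2) (insert x (B \<inter> {x..}) \<union> down (y - 2) (Suc m))" by simp
  moreover have "y - 1 \<in> B" "y - 2 \<notin> B"
    using low[of "y - 1"] low[of "y - 2"] Suc.prems(2) by (auto simp: in_down_iff)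
  moreover have "{y - 2<..<y - 1} = {}" by auto
  moreover have "B \<inter> {y - 1<..<x} = {}" using gap by force
  ultimately show ?case using Suc.prems(2) by (intro bump.step[of "y - 1" B x "y - 2"]) auto
qed

text \<open>The chain descends through the upper progression until \<open>t\<close> is displaced. As
  \<open>t - 1\<close> and \<open>t - 2\<close> are occupied, the next vacancy is
  \<open>t - 3\<close>, and the three consecutive values move down by one as a whole; then the lower
  progression shifts too. The result has the same form with \<open>t - 1\<close> and
  \<open>Suc q\<close>, which allows iteration.\<close>

lemma bump_block:
  assumes "\<And>z. z \<in> H \<Longrightarrow> t + 2 * int q + 1 < z"
  shows "bump (H \<union> down (t + 2 * int q) q \<union> {t, t - 1, t - 2} \<union> down (t - 6) m) (t + 2 * int q + 1)
    (H \<union> down (t + 2 * int q + 1) (Suc q) \<union> {t - 1, t - 2, t - 3} \<union> down (t - 7) m)"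
  using assms
proof (induction q arbitrary: H)
  case 0
  let ?B = "insert (t + 1) ((H \<union> {t, t - 1, t - 2} \<union> down (t - 6) m) - {t})"
  have H: "z \<notin> H" if "z \<le> t + 1" for z using 0[of z] that by auto
  have D: "z \<notin> down y m" if "y < z" for y z using that by (auto simp: in_down_iff)
  have "bump ?B (t - 3) (insert (t - 3) (?B \<inter> {t - 3..}) \<union> down (t - 5 - 2) m)"
  proof (rule bump_alternating)
    show "z \<in> ?B \<longleftrightarrow> z \<in> down (t - 5 - 1) m" if "z < t - 3" for z
      using that H[of z] by auto
  qed simp
  moreover have "insert (t - 3) (?B \<inter> {t - 3..}) \<union> down (t - 5 - 2) m =
     H \<union> down (t + 1) (Suc 0) \<union> {t - 1, t - 2, t - 3} \<union> down (t - 7) m"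
  proof (intro set_eqI)
    fix z
    show "z \<in> insert (t - 3) (?B \<inter> {t - 3..}) \<union> down (t - 5 - 2) m \<longleftrightarrow>
       z \<in> H \<union> down (t + 1) (Suc 0) \<union> {t - 1, t - 2, t - 3} \<union> down (t - 7) m"
      using H[of z] D[of "t - 6" z] by (cases "z \<le> t + 1"; cases "z < t - 3") (auto simp: down_Suc)
  qed
  ultimately have "bump ?B (t - 3) (H \<union> down (t + 1) (Suc 0) \<union> {t - 1, t - 2, t - 3} \<union> down (t - 7) m)"
    by simp
  moreover have "{t<..<t + 1} = {}" by auto
  moreover have "{t - 3<..<t} \<subseteq> H \<union> {t, t - 1, t - 2} \<union> down (t - 6) m" by auto
  ultimately show ?case
    using bump.step[of t "H \<union> {t, t - 1, t - 2} \<union> down (t - 6) m" "t + 1" "t - 3"] H[of "t - 3"] D[of "t - 6"] by auto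
next
  case (Suc q)
  let ?x = "t + 2 * int q + 3"
  let ?B = "H \<union> down (?x - 1) (Suc q) \<union> {t, t - 1, t - 2} \<union> down (t - 6) m"
  have H: "z \<notin> H" if "z \<le> ?x" for z using Suc.prems[of z] that by auto
  have x2: "?x - 2 = t + 2 * int q + 1" by simp
  have IH: "bump (insert ?x H \<union> down (t + 2 * int q) q \<union> {t, t - 1, t - 2} \<union> down (t - 6) m) (t + 2 * int q + 1)
    (insert ?x H \<union> down (t + 2 * int q + 1) (Suc q) \<union> {t - 1, t - 2, t - 3} \<union> down (t - 7) m)"
    by (rule Suc.IH) (use Suc.prems in force)
  have eq1: "insert ?x H \<union> down (t + 2 * int q) q \<union> {t, t - 1, t - 2} \<union> down (t - 6) m = insert ?x (?B - {?x - 1})"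
    unfolding down_Suc using H[of "?x - 1"] by (auto simp: in_down_iff)
  have eq2: "insert ?x H \<union> down (t + 2 * int q + 1) (Suc q) = H \<union> down ?x (Suc (Suc q))"
    unfolding down_Suc[of ?x] x2 by blast
  have "bump (insert ?x (?B - {?x - 1})) (?x - 2)
      (H \<union> down ?x (Suc (Suc q)) \<union> {t - 1, t - 2, t - 3} \<union> down (t - 7) m)"
    using IH unfolding eq1 eq2 x2 .
  moreover have "?x - 1 \<in> ?B" "?x - 2 \<notin> ?B"
    using H[of "?x - 2"] by (auto simp: in_down_iff)
  moreover have "{?x - 2<..<?x - 1} = {}" "{?x - 1<..<?x} = {}" by auto
  ultimately have "bump ?B ?x (H \<union> down ?x (Suc (Suc q)) \<union> {t - 1, t - 2, t - 3} \<union> down (t - 7) m)"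
    by (intro bump.step[of "?x - 1" ?B ?x "?x - 2"]) auto
  then show ?case by (simp add: algebra_simps)
qed

section \<open>The longest element and its triples\<close>

definition rev_perm :: "nat \<Rightarrow> int \<Rightarrow> int" where
  "rev_perm n i = (if 1 \<le> i \<and> i \<le> int n then int n + 1 - i else i)"

text \<open>The permutation u_c of the overview, since s_c s_(c+1) s_c transposes \<open>c\<close>
  and \<open>c + 2\<close>: a decreasing sequence in which only the values c, c+1, c+2 stand in
  increasing order.\<close>

definition rev_perm3 :: "nat \<Rightarrow> nat \<Rightarrow> int \<Rightarrow> int" where
  "rev_perm3 n c = transpose (int c) (int c + 2) \<circ> rev_perm n"

lemma permutation_rev_perm: "permutation (rev_perm n)"
proof -
  have "bij (rev_perm n)"
    by (rule o_bij[of "rev_perm n"]) (auto simp: rev_perm_def fun_eq_iff)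
  moreover have "{x. rev_perm n x \<noteq> x} \<subseteq> {1..int n}" by (auto simp: rev_perm_def)
  then have "finite {x. rev_perm n x \<noteq> x}" by (rule finite_subset) simp
  ultimately show ?thesis by (simp add: permutation)
qed

lemma permutation_rev_perm3: "permutation (rev_perm3 n c)"
  unfolding rev_perm3_def by (intro permutation_compose permutation_rev_perm permutation_swap_id)

lemma absorbed_init:
  assumes "permutation v" "\<And>i. i < 1 \<or> int n < i \<Longrightarrow> v i = i"
  shows "absorbed v (int n) {int n<..}"
  unfolding absorbed_def
proof (intro exI[of _ v] conjI)
  show "v ` {int n<..} = {int n<..}" using assms(2) by (simp cong: image_cong_simp)
qed (use assms in \<open>auto simp: strict_mono_on_def\<close>)

text \<open>The progression shifts to top \<open>k - 1\<close>, at distance 2 from the new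
  \<open>k + 1\<close>, so it stays evenly spaced.\<close>

lemma bump_interval:
  assumes "k < n"
  shows "bump ({int n<..} \<union> down (int k) k) (int k + 1) ({int n<..} \<union> down (int (Suc k)) (Suc k))"
proof -
  let ?B = "{int n<..} \<union> down (int k) k"
  have "bump ?B (int k + 1) (insert (int k + 1) (?B \<inter> {int k + 1..}) \<union> down (int k + 1 - 2) k)"
    by (rule bump_alternating) (use assms in auto)
  moreover have "?B \<inter> {int k + 1..} = {int n<..}" using assms by (auto simp: in_down_iff)
  ultimately show ?thesis by (simp add: down_Suc add.commute)
qed

lemma absorbed_initial_run:
  assumes "permutation v" "\<And>i. i < 1 \<or> int n < i \<Longrightarrow> v i = i" "K \<le> n"
    and v: "\<And>i. int n - int K < i \<Longrightarrow> i \<le> int n \<Longrightarrow> v i = int n + 1 - i"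
    and big: "\<And>m. 1 \<le> m \<Longrightarrow> m \<le> int n - int K \<Longrightarrow> int K \<le> v m"
  shows "absorbed v (int n - int K) ({int n<..} \<union> down (int K) K)"
proof -
  have "absorbed v (int n - int k) ({int n<..} \<union> down (int k) k)" if "k \<le> K" for k
    using that
  proof (induction k)
    case 0
    then show ?case using absorbed_init[OF assms(1,2)] by simp
  next
    case (Suc k)
    have vr: "v (int n - int k) = int k + 1" using v[of "int n - int k"] Suc.prems by simp
    have "absorbed v (int n - int k - 1) ({int n<..} \<union> down (int (Suc k)) (Suc k))"
    proof (rule absorbed_step)
      show "absorbed v (int n - int k) ({int n<..} \<union> down (int k) k)" using Suc by simp
      show "1 \<le> int n - int k" using Suc.prems assms(3) by simp
      show "bump ({int n<..} \<union> down (int k) k) (v (int n - int k)) ({int n<..} \<union> down (int (Suc k)) (Suc k))"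
        unfolding vr using Suc.prems assms(3) by (intro bump_interval) simp
      show "b < v m" if "1 \<le> m" "m < int n - int k" "b < v (int n - int k)" for m b
        using that v[of m] big[of m] Suc.prems unfolding vr by (cases "m \<le> int n - int K") auto
    qed
    then show ?case by (simp add: algebra_simps)
  qed
  then show ?thesis by simp
qed

lemma absorbed_rev_perm: "absorbed (rev_perm n) 0 ({int n<..} \<union> down (int n) n)"
proof -
  have "absorbed (rev_perm n) (int n - int n) ({int n<..} \<union> down (int n) n)"
    by (intro absorbed_initial_run permutation_rev_perm) (auto simp: rev_perm_def)
  then show ?thesis by simp
qed

lemma rev_perm3_apply:
  assumes "1 \<le> c" "c + 2 \<le> n"
  shows "rev_perm3 n c i = (if i = int n + 1 - int c then int c + 2
     else if i = int n - 1 - int c then int c else rev_perm n i)"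
  using assms by (auto simp: rev_perm3_def rev_perm_def transpose_def)

text \<open>Absorbing the values c+2, c+1, c in this order leaves three consecutive values with top
  c + 2. Each of the remaining n - c - 2 absorptions lowers the top by one, which gives
  \<open>t\<close>.\<close>

lemma absorbed_rev_perm3:
  assumes c: "1 \<le> c" "c + 2 \<le> n"
  defines "t \<equiv> 2 * int c + 4 - int n"
  shows "absorbed (rev_perm3 n c) 0 ({int n<..} \<union> down (int n) (n - c - 2) \<union> {t, t - 1, t - 2}
           \<union> down (t - 6) (c - 1))"
proof -
  define v where "v = rev_perm3 n c"
  note vx = rev_perm3_apply[OF c, folded v_def]
  have vge: "int c \<le> v m" if "1 \<le> m" "m \<le> int n - int c + 1" for m
    using that c by (auto simp: vx rev_perm_def)
  let ?H = "{int n<..}"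
  have 1: "absorbed v (int n - int c + 1) (?H \<union> down (int c - 1) (c - 1))"
  proof -
    have "absorbed v (int n - int (c - 1)) (?H \<union> down (int (c - 1)) (c - 1))"
      using c by (intro absorbed_initial_run) (auto simp: v_def permutation_rev_perm3 rev_perm3_apply rev_perm_def)
    then show ?thesis using c by (simp add: of_nat_diff algebra_simps)
  qed
  have 2: "absorbed v (int n - int c) (?H \<union> {int c + 2} \<union> down (int c - 2) (c - 1))"
  proof -
    let ?B = "?H \<union> down (int c - 1) (c - 1)"
    have vr: "v (int n - int c + 1) = int c + 2" using c by (simp add: vx)
    have "bump ?B (int c + 2) (insert (int c + 2) (?B \<inter> {int c + 2..}) \<union> down (int c - 2) (c - 1))"
      by (rule bump_alternating) (use c in auto)
    moreover have "?B \<inter> {int c + 2..} = ?H" using c by (auto simp: in_down_iff)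
    ultimately have "bump ?B (v (int n - int c + 1)) (?H \<union> {int c + 2} \<union> down (int c - 2) (c - 1))"
      by (simp add: vr)
    from absorbed_step[OF 1 _ this] show ?thesis
      unfolding vr using c vge by (fastforce simp: in_down_iff)
  qed
  have 3: "absorbed v (int n - int c - 1) (?H \<union> {int c + 2, int c + 1} \<union> down (int c - 3) (c - 1))"
  proof -
    let ?B = "?H \<union> {int c + 2} \<union> down (int c - 2) (c - 1)"
    have vr: "v (int n - int c) = int c + 1" using c by (simp add: vx rev_perm_def)
    have "bump ?B (int c + 1) (insert (int c + 1) (?B \<inter> {int c + 1..}) \<union> down (int c - 1 - 2) (c - 1))"
      by (rule bump_alternating) (use c in auto)
    moreover have "?B \<inter> {int c + 1..} = ?H \<union> {int c + 2}" using c by (auto simp: in_down_iff)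
    ultimately have "bump ?B (v (int n - int c)) (?H \<union> {int c + 2, int c + 1} \<union> down (int c - 3) (c - 1))"
      unfolding vr by (simp only:) (simp add: insert_commute)
    from absorbed_step[OF 2 _ this] show ?thesis
      unfolding vr using c vge by (fastforce simp: in_down_iff)
  qed
  have 4: "absorbed v (int n - int c - 2) (?H \<union> {int c + 2, int c + 1, int c} \<union> down (int c - 4) (c - 1))"
  proof -
    let ?B = "?H \<union> {int c + 2, int c + 1} \<union> down (int c - 3) (c - 1)"
    have vr: "v (int n - int c - 1) = int c" using c by (simp add: vx)
    have "bump ?B (int c) (insert (int c) (?B \<inter> {int c..}) \<union> down (int c - 2 - 2) (c - 1))"
      by (rule bump_alternating) (use c in auto)
    moreover have "?B \<inter> {int c..} = ?H \<union> {int c + 2, int c + 1}" using c by (auto simp: in_down_iff)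
    ultimately have "bump ?B (v (int n - int c - 1)) (?H \<union> {int c + 2, int c + 1, int c} \<union> down (int c - 4) (c - 1))"
      unfolding vr by (simp only:) (simp add: insert_commute)
    from absorbed_step[OF 3 _ this] show ?thesis
      unfolding vr using c vge by (fastforce simp: in_down_iff)
  qed
  \<comment> \<open>State \<open>4\<close> is the pattern of \<open>bump_block\<close> with
    \<open>t\<close> replaced by c + 2 and an empty upper progression; from here on that lemma is
    iterated.\<close>
  have 5: "absorbed v (int n - int c - 2 - int q) (?H \<union> down (int c + 2 + int q) q
     \<union> {int c + 2 - int q, int c + 1 - int q, int c - int q} \<union> down (int c - 4 - int q) (c - 1))"
    if "q \<le> n - c - 2" for q
    using that
  proof (induction q)
    case 0
    then show ?case using 4 by simp
  next
    case (Suc q)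
    let ?r = "int n - int c - 2 - int q" and ?t = "int c + 2 - int q"
    have r: "1 \<le> ?r" using Suc.prems c by linarith
    have vr: "v m = int n + 1 - m" if "1 \<le> m" "m \<le> ?r" for m using that c by (simp add: vx rev_perm_def)
    have bump: "bump (?H \<union> down (?t + 2 * int q) q \<union> {?t, ?t - 1, ?t - 2} \<union> down (?t - 6) (c - 1)) (?t + 2 * int q + 1)
       (?H \<union> down (?t + 2 * int q + 1) (Suc q) \<union> {?t - 1, ?t - 2, ?t - 3} \<union> down (?t - 7) (c - 1))"
      by (rule bump_block) (use r in auto)
    have "absorbed v (?r - 1) (?H \<union> down (?t + 2 * int q + 1) (Suc q) \<union> {?t - 1, ?t - 2, ?t - 3} \<union> down (?t - 7) (c - 1))"
    proof (rule absorbed_step[OF _ r])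
      show "absorbed v ?r (?H \<union> down (?t + 2 * int q) q \<union> {?t, ?t - 1, ?t - 2} \<union> down (?t - 6) (c - 1))"
        using Suc by (simp add: algebra_simps)
      show "bump (?H \<union> down (?t + 2 * int q) q \<union> {?t, ?t - 1, ?t - 2} \<union> down (?t - 6) (c - 1)) (v ?r)
       (?H \<union> down (?t + 2 * int q + 1) (Suc q) \<union> {?t - 1, ?t - 2, ?t - 3} \<union> down (?t - 7) (c - 1))"
        using bump vr[OF r] by (simp add: algebra_simps)
      show "b < v m" if "1 \<le> m" "m < ?r" "b < v ?r" for m b
        using that vr[OF r] vr[of m] by simp
    qed
    then show ?case by (simp add: algebra_simps)
  qed
  have q: "int (n - c - 2) = int n - int c - 2" using c by simp
  show ?thesis using 5[OF order_refl] unfolding q v_def[symmetric] t_def by (simp add: algebra_simps)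
qed

section \<open>Product formulas for the staircase\<close>

lemma down_props: "finite (down y m)" "card (down y m) = m"
  "(\<Sum>x\<in>down y m. real_of_int (x - (y - 2 * int m + 2))) = real m * (real m - 1)"
proof -
  have inj: "inj_on (\<lambda>j. y - 2 * int j) {..<m}" by (auto simp: inj_on_def)
  show "finite (down y m)" "card (down y m) = m" by (simp_all add: down_def card_image[OF inj])
  show "(\<Sum>x\<in>down y m. real_of_int (x - (y - 2 * int m + 2))) = real m * (real m - 1)"
  proof (induction m)
    case (Suc m)
    \<comment> \<open>The reference point is the least element: it drops by 2, so every old term
      grows by 2 and the new one is 0.\<close>
    have "(\<Sum>x\<in>down y (Suc m). real_of_int (x - (y - 2 * int (Suc m) + 2))) =
        (\<Sum>x\<in>down y m. real_of_int (x - (y - 2 * int m + 2)) + 2)"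
    proof -
      have "down y (Suc m) = insert (y - 2 * int m) (down y m)" "y - 2 * int m \<notin> down y m"
        by (auto simp: down_def lessThan_Suc)
      then show ?thesis by (simp add: down_def algebra_simps)
    qed
    moreover have "card (down y m) = m" by (simp add: down_def card_image inj_on_def)
    ultimately show ?case using Suc by (simp add: sum.distrib algebra_simps del: of_int_diff)
  qed simp
qed

text \<open>The coefficient of x^p in (1-x)^(-5/2).\<close>

definition bcoef :: "nat \<Rightarrow> real" where
  "bcoef p = (\<Prod>i<p. (2 * real i + 5) / (2 * real i + 2))"

text \<open>The index of the moved element is \<open>k + 2\<close>; the three leading factors are
  the quotient of the factorials in \<open>frob_move\<close> and the product comes from the elements
  below. The absolute value matters only at \<open>i = 0\<close>.\<close>

lemma lower_product:
  "(2 * real (k + 2)) * (2 * real (k + 2) - 1) * (2 * real (k + 2) - 2) *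
     (\<Prod>i<k + 2. \<bar>2 * real i - 1\<bar> / (2 * real i + 2)) = 3 * bcoef k"
proof (induction k)
  case 0
  show ?case by (simp add: bcoef_def numeral_2_eq_2)
next
  case (Suc k)
  let ?P = "\<Prod>i<k + 2. \<bar>2 * real i - 1\<bar> / (2 * real i + 2)"
  let ?C = "\<lambda>k. (2 * real (k + 2)) * (2 * real (k + 2) - 1) * (2 * real (k + 2) - 2)"
  have "(\<Prod>i<Suc k + 2. \<bar>2 * real i - 1\<bar> / (2 * real i + 2)) = ?P * ((2 * real k + 3) / (2 * real k + 6))"
    by (simp add: add.commute)
  then have "?C (Suc k) * (\<Prod>i<Suc k + 2. \<bar>2 * real i - 1\<bar> / (2 * real i + 2)) =
      ?C (Suc k) * ((2 * real k + 3) / (2 * real k + 6)) * ?P" by (simp only: mult_ac)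
  also have "?C (Suc k) * ((2 * real k + 3) / (2 * real k + 6)) = ?C k * ((2 * real k + 5) / (2 * real k + 2))"
    by (simp add: divide_simps) (simp add: algebra_simps)
  also have "\<dots> * ?P = (?C k * ?P) * ((2 * real k + 5) / (2 * real k + 2))" by (simp only: mult_ac)
  also have "\<dots> = 3 * bcoef (Suc k)" unfolding Suc by (simp add: bcoef_def)
  finally show ?case .
qed

text \<open>Lowering 2m by 3 among the even numbers 0, 2, ..., 2n-2. Counting outwards from
  \<open>m\<close>, each element above contributes (2i+5)/(2i+2), a factor of
  \<open>bcoef\<close>.\<close>

lemma move_product:
  assumes "m < n"
  shows "(\<Prod>j\<in>{..<n} - {m}. \<bar>2 * real m - 3 - 2 * real j\<bar> / \<bar>2 * real m - 2 * real j\<bar>) =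
    (\<Prod>i<m. \<bar>2 * real i - 1\<bar> / (2 * real i + 2)) * bcoef (n - 1 - m)"
proof -
  let ?f = "\<lambda>j. \<bar>2 * real m - 3 - 2 * real j\<bar> / \<bar>2 * real m - 2 * real j\<bar>"
  have "{..<n} - {m} = {..<m} \<union> {m<..<n}" using assms by auto
  moreover have "{..<m} \<inter> {m<..<n} = {}" by auto
  ultimately have "prod ?f ({..<n} - {m}) = prod ?f {..<m} * prod ?f {m<..<n}"
    by (simp only: prod.union_disjoint finite_lessThan finite_greaterThanLessThan)
  moreover have "prod ?f {..<m} = (\<Prod>i<m. \<bar>2 * real i - 1\<bar> / (2 * real i + 2))"
    by (rule prod.reindex_bij_witness[where i = "\<lambda>i. m - 1 - i" and j = "\<lambda>j. m - 1 - j"])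
       (auto simp: of_nat_diff abs_minus_commute)
  moreover have "prod ?f {m<..<n} = bcoef (n - 1 - m)"
    unfolding bcoef_def
    by (rule prod.reindex_bij_witness[where i = "\<lambda>i. m + 1 + i" and j = "\<lambda>j. j - m - 1"])
       (auto simp: of_nat_diff abs_if)
  ultimately show ?thesis by (simp only:)
qed

text \<open>The square of (1-x)^(-5/2) is (1-x)^(-5), so the value is the binomial coefficient of M
  + 4 over 4. Averaging over \<open>k\<close> and \<open>M - k\<close> turns the recursion of
  \<open>bcoef\<close> into a first-order recursion for the convolution.\<close>

lemma sum_bcoef:
  "(\<Sum>k\<le>M. bcoef k * bcoef (M - k)) = (real M + 1) * (real M + 2) * (real M + 3) * (real M + 4) / 24"
proof (induction M)
  case 0
  show ?case by (simp add: bcoef_def)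
next
  case (Suc M)
  let ?S = "\<lambda>M. \<Sum>k\<le>M. bcoef k * bcoef (M - k)"
  have sym: "2 * (\<Sum>k\<le>M. (real k + a) * (bcoef k * bcoef (M - k))) = (real M + 2 * a) * ?S M" for a M
  proof -
    have "(\<Sum>k\<le>M. (real k + a) * (bcoef k * bcoef (M - k))) =
        (\<Sum>k\<le>M. (real M - real k + a) * (bcoef k * bcoef (M - k)))"
      by (rule sum.reindex_bij_witness[where i = "\<lambda>k. M - k" and j = "\<lambda>k. M - k"]) (auto simp: of_nat_diff)
    then have "2 * (\<Sum>k\<le>M. (real k + a) * (bcoef k * bcoef (M - k))) =
        (\<Sum>k\<le>M. (real k + a) * (bcoef k * bcoef (M - k)) + (real M - real k + a) * (bcoef k * bcoef (M - k)))"
      by (simp only: sum.distrib)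
    also have "\<dots> = (real M + 2 * a) * ?S M"
      unfolding sum_distrib_left by (intro sum.cong refl) (simp add: algebra_simps)
    finally show ?thesis .
  qed
  have rec: "real (Suc k) * bcoef (Suc k) = (real k + 5 / 2) * bcoef k" for k
    by (simp add: bcoef_def divide_simps) (simp add: algebra_simps)
  have "real (Suc M) * ?S (Suc M) = 2 * (\<Sum>k\<le>Suc M. real k * (bcoef k * bcoef (Suc M - k)))"
    using sym[where a = 0 and M = "Suc M"] by simp
  also have "\<dots> = 2 * (\<Sum>k\<le>M. (real (Suc k) * bcoef (Suc k)) * bcoef (M - k))"
    by (subst sum.atMost_Suc_shift) (simp add: mult.assoc)
  also have "\<dots> = (real M + 5) * ?S M"
    unfolding rec using sym[where a = "5 / 2" and M = M] by (simp add: mult.assoc)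
  finally have "(real M + 1) * ?S (Suc M) = (real M + 5) * ?S M" by (simp add: add.commute)
  then have "(real M + 1) * ?S (Suc M) =
      (real M + 1) * ((real (Suc M) + 1) * (real (Suc M) + 2) * (real (Suc M) + 3) * (real (Suc M) + 4) / 24)"
    unfolding Suc.IH by (simp add: algebra_simps)
  then show ?case by simp
qed

lemma nred_rev_perm:
  obtains N where "real N = real n * (real n - 1) / 2"
    "real (nred (rev_perm n)) = fact N * frob (1 - int n) (down (int n - 1) n)"
proof -
  let ?B = "{int n<..} \<union> down (int n) n"
  \<comment> \<open>Measured from 1 - n these are the beta numbers 0, 2, ..., 2n-2, that is, the
    staircase with rows n-1, ..., 1, 0.\<close>
  have "down (int n - 1) n = {1 - int n..} - ?B"
    by (auto simp: in_down_iff; presburger)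
  moreover have "?B \<inter> {..<1 - int n} = {}" by (auto simp: in_down_iff)
  ultimately obtain N where N: "real N = (\<Sum>x\<in>down (int n - 1) n. real_of_int (x - (1 - int n)))
      - real n * (real n - 1) / 2" "real (nred (rev_perm n)) = fact N * frob (1 - int n) (down (int n - 1) n)"
    using nred_absorbed[OF absorbed_rev_perm, of n "1 - int n" "down (int n - 1) n"] down_props(2) by metis
  moreover have "(\<Sum>x\<in>down (int n - 1) n. real_of_int (x - (1 - int n))) = real n * (real n - 1)"
    using down_props(3)[of "int n - 1" n] by (simp add: algebra_simps)
  ultimately show ?thesis using that[of N] by simp
qed

lemma nred_rev_perm3:
  assumes c: "1 \<le> c" "c + 2 \<le> n"
  obtains N where "real N = real n * (real n - 1) / 2 - 3"
    "real (nred (rev_perm3 n c)) =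
       fact N * (frob (1 - int n) (down (int n - 1) n) * (3 * bcoef (c - 1) * bcoef (n - 2 - c)))"
proof -
  define t where "t = 2 * int c + 4 - int n"
  define b where "b = 1 - int n"
  define L where "L = down (int n - 1) n"
  let ?B = "{int n<..} \<union> down (int n) (n - c - 2) \<union> {t, t - 1, t - 2} \<union> down (t - 6) (c - 1)"
  let ?L = "insert (t - 4) (L - {t - 1})"
  have q: "int (n - c - 2) = int n - int c - 2" "int (c - 1) = int c - 1" using c by simp_all
  have L: "x \<in> L \<longleftrightarrow> b \<le> x \<and> x < int n \<and> odd (int n - x)" for x
    unfolding L_def in_down_iff b_def by presburger
  have B: "x \<in> ?B \<longleftrightarrow> int n < x \<or> x \<le> int n \<and> t < x \<and> even (int n - x) \<or> t - 2 \<le> x \<and> x \<le> t \<or>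
      x \<le> t - 6 \<and> b < x \<and> even (int n - x)" for x
    unfolding Un_iff in_down_iff q t_def b_def using c by auto presburger+
  have tb: "b + 3 \<le> t - 4 + 2" "t \<le> int n" "even (int n - t)" "odd (int n - b)" unfolding t_def b_def using c by auto
  \<comment> \<open>Split by the parity of n - x. Among the odd ones only \<open>t - 1\<close> is
    lost, being inside the consecutive triple; among the even ones only \<open>t - 4\<close> is
    gained, being in the gap between \<open>t - 2\<close> and \<open>t - 6\<close>. Moving a beta
    number down by 3 removes the border strip.\<close>
  have "?L = {b..} - ?B"
  proof (intro set_eqI)
    fix x
    show "x \<in> ?L \<longleftrightarrow> x \<in> {b..} - ?B"
    proof (cases "even (int n - x)")
      case True
      then have "x \<noteq> t - 3" "x \<noteq> t - 5" "x \<noteq> t - 1" "x \<noteq> b" using tb by auto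
      then show ?thesis
        unfolding Diff_iff insert_iff B L singleton_iff atLeast_iff empty_iff using True tb(1,2) by (smt (verit))
    next
      case False
      then have "x \<noteq> t - 4" "x \<noteq> t - 2" "x \<noteq> t" "x \<noteq> int n" using tb by auto
      then show ?thesis
        unfolding Diff_iff insert_iff B L singleton_iff atLeast_iff empty_iff using False tb(1,2) by (smt (verit))
    qed
  qed
  moreover have "x \<notin> ?B" if "x < b" for x unfolding B using that tb by auto
  then have "?B \<inter> {..<b} = {}" by blast
  ultimately obtain N where N: "real N = (\<Sum>x\<in>?L. real_of_int (x - b)) - real (card ?L) * (real (card ?L) - 1) / 2"
    "real (nred (rev_perm3 n c)) = fact N * frob b ?L"
    using nred_absorbed[OF absorbed_rev_perm3[OF c, folded t_def], of b ?L] by metis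
  have fin: "finite L" and card: "card L = n" by (simp_all add: L_def down_props)
  have mem: "t - 1 \<in> L" "t - 4 \<notin> L" unfolding L using tb by auto
  have cL: "card ?L = n" using fin mem card by (metis card_Suc_Diff1 card_insert_disjoint finite_Diff Diff_iff)
  have "(\<Sum>x\<in>?L. real_of_int (x - b)) = (\<Sum>x\<in>L. real_of_int (x - b)) - 3"
    using fin mem by (simp add: sum_diff1)
  moreover have "(\<Sum>x\<in>L. real_of_int (x - b)) = real n * (real n - 1)"
    using down_props(3)[of "int n - 1" n] by (simp add: L_def b_def algebra_simps)
  ultimately have N1: "real N = real n * (real n - 1) / 2 - 3" using N(1) cL by simp
  have xb: "nat (t - 1 - b) = 2 * c + 2" "nat (t - 4 - b) = 2 * c - 1"
    unfolding t_def b_def using c by auto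
  have prod: "(\<Prod>y\<in>L - {t - 1}. \<bar>real_of_int (t - 4 - y)\<bar> / \<bar>real_of_int (t - 1 - y)\<bar>) =
      (\<Prod>i<c - 1 + 2. \<bar>2 * real i - 1\<bar> / (2 * real i + 2)) * bcoef (n - 2 - c)"
  proof -
    have "(\<Prod>y\<in>L - {t - 1}. \<bar>real_of_int (t - 4 - y)\<bar> / \<bar>real_of_int (t - 1 - y)\<bar>) =
       (\<Prod>j\<in>{..<n} - {c + 1}. \<bar>2 * real (c + 1) - 3 - 2 * real j\<bar> / \<bar>2 * real (c + 1) - 2 * real j\<bar>)"
    proof (rule prod.reindex_bij_witness[where i = "\<lambda>j. b + 2 * int j" and j = "\<lambda>y. nat ((y - b) div 2)"])
      fix y assume "y \<in> L - {t - 1}"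
      then have y: "b \<le> y" "y < int n" "odd (int n - y)" "y \<noteq> t - 1" using L by auto
      then show 1: "b + 2 * int (nat ((y - b) div 2)) = y" unfolding b_def by auto
      have "k \<in> {..<n} - {c + 1}" if "b + 2 * int k = y" for k
        using that y unfolding b_def t_def by auto
      from this[OF 1] show "nat ((y - b) div 2) \<in> {..<n} - {c + 1}" .
      have "\<bar>2 * real (c + 1) - 3 - 2 * real k\<bar> / \<bar>2 * real (c + 1) - 2 * real k\<bar> =
          \<bar>real_of_int (t - 4 - y)\<bar> / \<bar>real_of_int (t - 1 - y)\<bar>" if "b + 2 * int k = y" for k
        unfolding that[symmetric] b_def t_def by (simp add: algebra_simps)
      from this[OF 1] show "\<bar>2 * real (c + 1) - 3 - 2 * real (nat ((y - b) div 2))\<bar> / \<bar>2 * real (c + 1) - 2 * real (nat ((y - b) div 2))\<bar> =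
          \<bar>real_of_int (t - 4 - y)\<bar> / \<bar>real_of_int (t - 1 - y)\<bar>" .
    next
      fix j assume "j \<in> {..<n} - {c + 1}"
      then show "nat ((b + 2 * int j - b) div 2) = j" "b + 2 * int j \<in> L - {t - 1}"
        unfolding Diff_iff L b_def t_def by auto
    qed
    also have "\<dots> = (\<Prod>i<c + 1. \<bar>2 * real i - 1\<bar> / (2 * real i + 2)) * bcoef (n - 1 - (c + 1))"
      by (rule move_product) (use c in simp)
    finally show ?thesis using c by (simp add: numeral_2_eq_2)
  qed
  have fact: "(fact (2 * c + 2) :: real) / fact (2 * c - 1) = (2 * real (c - 1 + 2)) * (2 * real (c - 1 + 2) - 1) * (2 * real (c - 1 + 2) - 2)"
  proof -
    have "2 * c + 2 = Suc (Suc (Suc (2 * c - 1)))" using c by simp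
    then have "(fact (2 * c + 2) :: real) = real (2 * c + 2) * real (2 * c + 1) * real (2 * c) * fact (2 * c - 1)"
      using c by (simp only: fact_Suc) (simp add: of_nat_diff algebra_simps)
    then have "(fact (2 * c + 2) :: real) / fact (2 * c - 1) = real (2 * c + 2) * real (2 * c + 1) * real (2 * c)"
      by (simp only: nonzero_mult_div_cancel_right[OF fact_nonzero])
    also have "\<dots> = (2 * real (c - 1 + 2)) * (2 * real (c - 1 + 2) - 1) * (2 * real (c - 1 + 2) - 2)"
      using c by (simp add: of_nat_diff algebra_simps)
    finally show ?thesis .
  qed
  have "frob b ?L = frob b L * (3 * bcoef (c - 1) * bcoef (n - 2 - c))"
    unfolding frob_move[OF fin mem] xb prod fact lower_product[of "c - 1", symmetric] by (simp add: mult_ac)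
  then show ?thesis using that[of N] N1 N(2) unfolding L_def b_def by simp
qed

text \<open>Reiner's theorem in disguise: with N inversions, N - 2 positions and two directions give
  one braid move per reduced word on average. The quotient of \<open>fact N\<close> by
  \<open>fact (N - 3)\<close> is N(N-1)(N-2), and the weighted convolution accounts for N(N-1)/2 of
  it.\<close>

lemma sum_nred_rev_perm3:
  assumes "3 \<le> n"
  shows "2 * (real n * (real n - 1) / 2 - 2) * (\<Sum>c\<in>{1..n - 2}. real (nred (rev_perm3 n c))) = real (nred (rev_perm n))"
proof -
  obtain N where N: "real N = real n * (real n - 1) / 2"
    "real (nred (rev_perm n)) = fact N * frob (1 - int n) (down (int n - 1) n)" (is "_ = _ * ?F")
    using nred_rev_perm .
  have "3 * 2 \<le> real n * (real n - 1)" using assms by (intro mult_mono) auto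
  then have N3: "3 \<le> N" using N(1) by simp
  have each: "real (nred (rev_perm3 n c)) = fact (N - 3) * (?F * (3 * bcoef (c - 1) * bcoef (n - 2 - c)))"
    if "c \<in> {1..n - 2}" for c
  proof -
    have "1 \<le> c" "c + 2 \<le> n" using that assms by auto
    from nred_rev_perm3[OF this] obtain N' where N': "real N' = real n * (real n - 1) / 2 - 3"
      "real (nred (rev_perm3 n c)) = fact N' * (?F * (3 * bcoef (c - 1) * bcoef (n - 2 - c)))" .
    have "N' = N - 3" using N'(1) N(1) by linarith
    then show ?thesis using N'(2) by simp
  qed
  have "(\<Sum>c\<in>{1..n - 2}. bcoef (c - 1) * bcoef (n - 2 - c)) = (\<Sum>k\<le>n - 3. bcoef k * bcoef (n - 3 - k))"
    by (rule sum.reindex_bij_witness[where i = Suc and j = "\<lambda>c. c - 1"]) (use assms in auto)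
  \<comment> \<open>Since N = n(n-1)/2, one has N - 1 = (n-2)(n+1)/2.\<close>
  also have "\<dots> = real N * (real N - 1) / 6"
    unfolding sum_bcoef N(1) using assms by (simp add: of_nat_diff field_simps)
  finally have S: "(\<Sum>c\<in>{1..n - 2}. bcoef (c - 1) * bcoef (n - 2 - c)) = real N * (real N - 1) / 6" .
  have "(\<Sum>c\<in>{1..n - 2}. real (nred (rev_perm3 n c))) = fact (N - 3) * ?F * 3 * (real N * (real N - 1) / 6)"
    unfolding S[symmetric] sum_distrib_left by (intro sum.cong refl) (simp add: each)
  moreover have "(fact N :: real) = real N * (real N - 1) * (real N - 2) * fact (N - 3)"
  proof -
    have "N = Suc (Suc (Suc (N - 3)))" using N3 by simp
    then have "(fact N :: real) = real (Suc (Suc (Suc (N - 3)))) * real (Suc (Suc (N - 3))) * real (Suc (N - 3)) * fact (N - 3)"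
      by (metis fact_Suc mult.assoc)
    then show ?thesis using N3 by (simp add: of_nat_diff)
  qed
  moreover have "2 * (x - 2) * (f * F * 3 * (x * (x - 1) / 6)) = x * (x - 1) * (x - 2) * f * F" for x f F :: real
    by (simp add: divide_simps)
  ultimately show ?thesis unfolding N(2) N(1)[symmetric] by (simp only:)
qed

section \<open>Rotation and braid classes\<close>

definition int_perm :: "(nat \<Rightarrow> nat) \<Rightarrow> int \<Rightarrow> int" where
  "int_perm f i = (if i < 0 then i else int (f (nat i)))"

lemma int_perm_comp: "int_perm (f \<circ> g) = int_perm f \<circ> int_perm g"
  by (auto simp: int_perm_def fun_eq_iff)

lemma int_perm_id: "int_perm id = id"
  by (auto simp: int_perm_def fun_eq_iff)

lemma int_perm_inject: "int_perm f = int_perm g \<Longrightarrow> f = g"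
proof
  fix x assume "int_perm f = int_perm g"
  then have "int_perm f (int x) = int_perm g (int x)" by simp
  then show "f x = g x" by (simp add: int_perm_def)
qed

lemma int_perm_simple_transp: "int_perm (simple_transp k) = adj (int k)"
  by (auto simp: int_perm_def simple_transp_def adj_def transpose_def fun_eq_iff)

lemma int_perm_word_perm: "int_perm (word_perm ws) = word_prod (map int ws)"
  by (induction ws) (simp_all only: word_perm.simps word_prod.simps list.map int_perm_id int_perm_comp int_perm_simple_transp)

lemma int_perm_longest_perm: "int_perm (longest_perm n) = rev_perm n"
  by (auto simp: int_perm_def longest_perm_def rev_perm_def fun_eq_iff)

lemma inversions_longest_perm: "inversions n (longest_perm n) = {(i, j). 1 \<le> i \<and> i < j \<and> j \<le> n}"
  by (auto simp: inversions_def longest_perm_def)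

lemma card_inversions_longest_perm: "2 * card (inversions n (longest_perm n)) = n * (n - 1)"
  unfolding inversions_longest_perm
proof (induction n)
  case 0
  have "{(i, j). 1 \<le> i \<and> i < j \<and> j \<le> (0::nat)} = {}" by auto
  then show ?case by (simp only: card.empty mult_0 mult_0_right)
next
  case (Suc n)
  have eq: "{(i, j). 1 \<le> i \<and> i < j \<and> j \<le> Suc n} = {(i, j). 1 \<le> i \<and> i < j \<and> j \<le> n} \<union> {1..n} \<times> {Suc n}"
    by auto
  have fin: "finite {(i, j). 1 \<le> i \<and> i < j \<and> j \<le> n}"
    by (rule finite_subset[of _ "{1..n} \<times> {1..n}"]) auto
  have "card {(i, j). 1 \<le> i \<and> i < j \<and> j \<le> Suc n} = card {(i, j). 1 \<le> i \<and> i < j \<and> j \<le> n} + n"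
    unfolding eq using fin by (subst card_Un_disjoint) (auto simp: card_cartesian_product)
  then show ?case using Suc by (cases n) auto
qed

lemma ninv_rev_perm: "ninv (rev_perm n) = card (inversions n (longest_perm n))"
proof -
  have "invs (rev_perm n) = map_prod int int ` inversions n (longest_perm n)"
  proof (intro equalityI subsetI)
    fix z assume "z \<in> invs (rev_perm n)"
    then obtain i j where z: "z = (i, j)" "i < j" "rev_perm n j < rev_perm n i" by (auto simp: invs_def)
    then have "1 \<le> i" "j \<le> int n" by (auto simp: rev_perm_def split: if_splits)
    then have "z = map_prod int int (nat i, nat j)" "(nat i, nat j) \<in> inversions n (longest_perm n)"
      using z by (auto simp: inversions_longest_perm)
    then show "z \<in> map_prod int int ` inversions n (longest_perm n)" by blast
  qed (auto simp: inversions_longest_perm invs_def rev_perm_def)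
  then show ?thesis unfolding ninv_def
    by (simp add: card_image prod.inj_map inj_on_subset[OF _ subset_UNIV])
qed

lemma red_word_rev_perm_iff:
  "red_word (map int ws) (rev_perm n) \<longleftrightarrow>
     word_perm ws = longest_perm n \<and> length ws = card (inversions n (longest_perm n))"
proof -
  have "word_prod (map int ws) = rev_perm n \<longleftrightarrow> word_perm ws = longest_perm n"
    using int_perm_inject int_perm_word_perm int_perm_longest_perm by metis
  then show ?thesis
    unfolding red_word_iff[OF permutation_rev_perm] ninv_rev_perm by simp
qed

text \<open>Enlarging the group to all integers adds no reduced words: a descent \<open>k\<close>
  outside the range would involve a fixed value, forcing both positions to be fixed and in
  order.\<close>

lemma red_word_letters:
  assumes "red_word ks w" "\<And>i. i < 1 \<or> n < i \<Longrightarrow> w i = i" "permutation w"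
  shows "set ks \<subseteq> {1..<n}"
  using assms
proof (induction ks arbitrary: w)
  case (Cons k ks)
  have inj: "w x = w y \<longleftrightarrow> x = y" for x y using permutation_eq_iff[OF Cons.prems(3)] .
  obtain p q where pq: "p < q" "w p = k + 1" "w q = k" using Cons.prems(1) by (auto simp: ldescents_def)
  have k1: "1 \<le> k"
  proof (rule ccontr)
    assume "\<not> 1 \<le> k"
    then have "w k = k" using Cons.prems(2)[of k] by simp
    then have "q = k" using pq inj[of q k] by simp
    then have "w p = p" using pq \<open>\<not> 1 \<le> k\<close> Cons.prems(2)[of p] by simp
    then show False using pq \<open>q = k\<close> by simp
  qed
  have kn: "k < n"
  proof (rule ccontr)
    assume "\<not> k < n"
    then have "w (k + 1) = k + 1" using Cons.prems(2)[of "k + 1"] by simp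
    then have "p = k + 1" using pq inj[of p "k + 1"] by simp
    then have "w q = q" using pq \<open>\<not> k < n\<close> Cons.prems(2)[of q] by simp
    then show False using pq \<open>p = k + 1\<close> by simp
  qed
  have "set ks \<subseteq> {1..<n}"
  proof (rule Cons.IH)
    show "red_word ks (adj k \<circ> w)" using Cons.prems(1) by simp
    show "(adj k \<circ> w) i = i" if "i < 1 \<or> n < i" for i
      using Cons.prems(2)[OF that] that k1 kn by (auto simp: adj_apply)
    show "permutation (adj k \<circ> w)" using permutation_adj_comp[OF Cons.prems(3)] .
  qed
  then show ?case using k1 kn by simp
qed simp

lemma red_words_rev_perm:
  "{ks. red_word ks (rev_perm n)} = map int ` reduced_words n (longest_perm n)"
proof (intro equalityI subsetI)
  fix ks assume "ks \<in> {ks. red_word ks (rev_perm n)}"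
  then have ks: "red_word ks (rev_perm n)" by simp
  have set: "set ks \<subseteq> {1..<int n}"
    by (rule red_word_letters[OF ks _ permutation_rev_perm]) (auto simp: rev_perm_def)
  then have "map int (map nat ks) = ks" unfolding map_map by (intro map_idI) auto
  moreover have "set (map nat ks) \<subseteq> {1..<n}" using set by fastforce
  ultimately have "map nat ks \<in> reduced_words n (longest_perm n)"
    using ks red_word_rev_perm_iff[of "map nat ks" n] by (simp add: reduced_words_def)
  then show "ks \<in> map int ` reduced_words n (longest_perm n)" using \<open>map int (map nat ks) = ks\<close> by (metis image_eqI)
qed (auto simp: reduced_words_def red_word_rev_perm_iff simp del: map_map)

lemma card_reduced_words: "card (reduced_words n (longest_perm n)) = nred (rev_perm n)"
  unfolding nred_def red_words_rev_perm by (rule card_image[symmetric]) (auto simp: inj_on_def)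

text \<open>Only one of the two braid patterns is recorded, so that every braid move, read in one
  direction, is counted once.\<close>

definition braid_at :: "nat \<Rightarrow> nat \<Rightarrow> nat \<Rightarrow> nat list set" where
  "braid_at n p a = {w \<in> reduced_words n (longest_perm n). \<exists>u v. length u = p \<and> w = u @ [a, a + 1, a] @ v}"

lemma finite_braid_at: "finite (braid_at n p a)"
  by (rule finite_subset[OF _ finite_reduced_words]) (auto simp: braid_at_def)

lemma card_braid_at_0: "card (braid_at n 0 a) \<le> nred (rev_perm3 n a)"
  unfolding nred_def
proof (rule card_inj_on_le)
  have triple: "adj (int a) \<circ> (adj (int a + 1) \<circ> (adj (int a) \<circ> rev_perm n)) = rev_perm3 n a"
    by (auto simp: fun_eq_iff rev_perm3_def adj_apply transpose_def)
  show "inj_on (\<lambda>w. map int (drop 3 w)) (braid_at n 0 a)"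
    by (auto simp: inj_on_def braid_at_def)
  show "(\<lambda>w. map int (drop 3 w)) ` braid_at n 0 a \<subseteq> {ks. red_word ks (rev_perm3 n a)}"
  proof clarify
    fix w assume w: "w \<in> braid_at n 0 a"
    then obtain v where v: "w = a # (a + 1) # a # v" by (auto simp: braid_at_def)
    have "red_word (map int w) (rev_perm n)"
      using w red_words_rev_perm[of n] by (auto simp: braid_at_def)
    then have "red_word (map int v) (adj (int a) \<circ> (adj (int a + 1) \<circ> (adj (int a) \<circ> rev_perm n)))"
      by (simp add: v add.commute)
    then show "red_word (map int (drop 3 w)) (rev_perm3 n a)" unfolding triple by (simp add: v)
  qed
qed (use finite_red_words[OF permutation_rev_perm3] in auto)

lemma word_perm_append: "word_perm (u @ v) = word_perm u \<circ> word_perm v"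
  by (induction u) (auto simp: comp_assoc)

lemma simple_transp_involutory: "simple_transp i \<circ> (simple_transp i \<circ> f) = f"
  by (auto simp: simple_transp_def fun_eq_iff)

lemma longest_perm_simple_transp:
  assumes "1 \<le> i" "i < n"
  shows "longest_perm n \<circ> simple_transp (n - i) = simple_transp i \<circ> longest_perm n"
  using assms by (auto simp: fun_eq_iff longest_perm_def simple_transp_def transpose_def)

text \<open>Rotation of reduced words of the longest element: since conjugation by it sends the i-th
  simple transposition to the (n - i)-th one, the first letter may be moved to the end.\<close>

lemma rotate_reduced_word:
  assumes "i # v \<in> reduced_words n (longest_perm n)"
  shows "v @ [n - i] \<in> reduced_words n (longest_perm n)"
proof -
  have i: "1 \<le> i" "i < n" and eq: "longest_perm n = simple_transp i \<circ> word_perm v"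
    using assms by (auto simp: reduced_words_def)
  have "word_perm v = simple_transp i \<circ> longest_perm n"
    unfolding eq by (simp only: simple_transp_involutory)
  then have "word_perm (v @ [n - i]) = simple_transp i \<circ> (longest_perm n \<circ> simple_transp (n - i))"
    by (simp add: word_perm_append comp_assoc)
  also have "\<dots> = longest_perm n"
    unfolding longest_perm_simple_transp[OF i] by (rule simple_transp_involutory)
  finally show ?thesis using assms i by (auto simp: reduced_words_def)
qed

text \<open>One rotation moves an occurrence one place to the left, so every position is bounded by
  the initial one.\<close>

lemma card_braid_at_le: "card (braid_at n p a) \<le> card (braid_at n 0 a)"
proof (induction p)
  case (Suc p)
  have "card (braid_at n (Suc p) a) \<le> card (braid_at n p a)"
  proof (rule card_inj_on_le)
    have form: "\<exists>i u v. w = i # u @ [a, a + 1, a] @ v \<and> length u = p \<and> i < n \<and>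
        w \<in> reduced_words n (longest_perm n)" if w: "w \<in> braid_at n (Suc p) a" for w
    proof -
      obtain u v where uv: "length u = Suc p" "w = u @ [a, a + 1, a] @ v" "w \<in> reduced_words n (longest_perm n)"
        using w unfolding braid_at_def by blast
      then obtain i u' where "u = i # u'" by (cases u) auto
      then show ?thesis using uv by (auto simp: reduced_words_def)
    qed
    \<comment> \<open>Letters are below \<open>n\<close>, so the truncated difference still
      determines the first letter.\<close>
    show "inj_on (\<lambda>w. tl w @ [n - hd w]) (braid_at n (Suc p) a)"
    proof (rule inj_onI)
      fix w w' assume "w \<in> braid_at n (Suc p) a" "w' \<in> braid_at n (Suc p) a" and eq: "tl w @ [n - hd w] = tl w' @ [n - hd w']"
      from form[OF this(1)] form[OF this(2)] obtain i x j y where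
        "w = i # x" "i < n" "w' = j # y" "j < n" by blast
      then show "w = w'" using eq by auto
    qed
    show "(\<lambda>w. tl w @ [n - hd w]) ` braid_at n (Suc p) a \<subseteq> braid_at n p a"
    proof clarify
      fix w assume "w \<in> braid_at n (Suc p) a"
      from form[OF this] obtain i u v where w: "w = i # u @ [a, a + 1, a] @ v" "length u = p"
        "w \<in> reduced_words n (longest_perm n)" by blast
      have "(u @ [a, a + 1, a] @ v) @ [n - i] \<in> reduced_words n (longest_perm n)"
        using rotate_reduced_word w by blast
      then show "tl w @ [n - hd w] \<in> braid_at n p a"
        unfolding braid_at_def w(1) using w(2) by (intro CollectI conjI exI[of _ u] exI[of _ "v @ [n - i]"]) auto
    qed
  qed (rule finite_braid_at)
  then show ?case using Suc by simp
qed simp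

text \<open>The bound "components at least vertices minus edges", with colours standing in for
  components. A new edge recolours one class with the colour of another, which loses at most one
  colour.\<close>

lemma exists_colouring:
  fixes F :: "('a \<times> 'a) set"
  assumes "finite F" "finite V"
  shows "\<exists>c :: 'a \<Rightarrow> 'a. (\<forall>(x, y)\<in>F. c x = c y) \<and> card V \<le> card (c ` V) + card F"
  using assms(1)
proof (induction F rule: finite_induct)
  case empty
  then show ?case by (intro exI[of _ id]) auto
next
  case (insert e F)
  obtain c :: "'a \<Rightarrow> 'a" where c: "\<forall>(x, y)\<in>F. c x = c y" "card V \<le> card (c ` V) + card F" using insert.IH by blast
  obtain u v where e: "e = (u, v)" by (cases e)
  define d where "d = (\<lambda>x. if c x = c u then c v else c x)"
  have "c ` V \<subseteq> insert (c u) (d ` V)" by (auto simp: d_def)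
  then have "card (c ` V) \<le> card (insert (c u) (d ` V))" using assms(2) by (intro card_mono) auto
  also have "\<dots> \<le> Suc (card (d ` V))" by (rule card_insert_le_m1) auto
  finally have "card V \<le> card (d ` V) + card (insert e F)" using c(2) insert.hyps by simp
  moreover have "\<forall>(x, y)\<in>insert e F. d x = d y" using c(1) by (auto simp: e d_def)
  ultimately show ?case by blast
qed

lemma word_perm_braid: "word_perm [a, a + 1, a] = word_perm [a + 1, a, a + 1]"
  by (auto simp: fun_eq_iff simple_transp_def transpose_def)

lemma braid_move_reduced_words:
  assumes "braid_move w w'" "w \<in> reduced_words n \<sigma>"
  shows "w' \<in> reduced_words n \<sigma>"
  using assms
proof cases
  case (up u a v)
  have "word_perm w' = word_perm w" unfolding up word_perm_append word_perm_braid ..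
  then show ?thesis using assms(2) by (auto simp: reduced_words_def up)
next
  case (down u a v)
  have "word_perm w' = word_perm w" unfolding down word_perm_append word_perm_braid ..
  then show ?thesis using assms(2) by (auto simp: reduced_words_def down)
qed

lemma card_reduced_words_le:
  "card (reduced_words n (longest_perm n)) \<le> card (braid_classes n (longest_perm n))
     + (card (inversions n (longest_perm n)) - 2) * (\<Sum>a\<in>{1..n - 2}. nred (rev_perm3 n a))"
proof -
  let ?R = "reduced_words n (longest_perm n)" and ?N = "card (inversions n (longest_perm n))"
  \<comment> \<open>\<open>F\<close> contains every braid move once, in the upward direction; a
    factor of length 3 has N - 2 possible positions in a word of length N.\<close>
  define E where "E = (\<lambda>p a. (\<lambda>w. (w, take p w @ [a + 1, a, a + 1] @ drop (p + 3) w)) ` braid_at n p a)"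
  define F where "F = (\<Union>p\<in>{..<?N - 2}. \<Union>a\<in>{1..n - 2}. E p a)"
  have upF: "(u @ [a, a + 1, a] @ v, u @ [a + 1, a, a + 1] @ v) \<in> F" if "u @ [a, a + 1, a] @ v \<in> ?R" for u a v
  proof -
    have "(u @ [a, a + 1, a] @ v, u @ [a + 1, a, a + 1] @ v) \<in> E (length u) a"
      unfolding E_def by (rule image_eqI[of _ _ "u @ [a, a + 1, a] @ v"]) (use that in \<open>auto simp: braid_at_def\<close>)
    moreover have "length u < ?N - 2" "a \<in> {1..n - 2}" using that by (auto simp: reduced_words_def)
    ultimately show ?thesis unfolding F_def by blast
  qed
  have "finite F" unfolding F_def E_def using finite_braid_at by blast
  have "card F \<le> (\<Sum>p<?N - 2. card (\<Union>a\<in>{1..n - 2}. E p a))"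
    unfolding F_def by (rule card_UN_le) simp
  also have "\<dots> \<le> (\<Sum>p<?N - 2. \<Sum>a\<in>{1..n - 2}. nred (rev_perm3 n a))"
  proof (rule sum_mono)
    fix p
    have "card (E p a) \<le> nred (rev_perm3 n a)" for a
      using card_image_le[OF finite_braid_at, of _ n p a] card_braid_at_le[of n p a] card_braid_at_0[of n a]
      unfolding E_def by (meson order_trans)
    then show "card (\<Union>a\<in>{1..n - 2}. E p a) \<le> (\<Sum>a\<in>{1..n - 2}. nred (rev_perm3 n a))"
      using card_UN_le[of "{1..n - 2}" "E p"] sum_mono[of "{1..n - 2}" "\<lambda>a. card (E p a)" "\<lambda>a. nred (rev_perm3 n a)"]
      by (meson finite_atLeastAtMost order_trans)
  qed
  finally have cardF: "card F \<le> (?N - 2) * (\<Sum>a\<in>{1..n - 2}. nred (rev_perm3 n a))" by simp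
  obtain c :: "nat list \<Rightarrow> nat list" where c: "\<forall>(x, y)\<in>F. c x = c y" "card ?R \<le> card (c ` ?R) + card F"
    using exists_colouring[OF \<open>finite F\<close> finite_reduced_words] by blast
  have move: "c w = c w'" if "braid_move w w'" "w \<in> ?R" for w w'
    using that(1)
  proof cases
    case (up u a v)
    then show ?thesis using upF[of u a v] that(2) c(1) by auto
  next
    case (down u a v)
    have "w' \<in> ?R" using braid_move_reduced_words[OF that] .
    then show ?thesis using down upF[of u a v] c(1) by auto
  qed
  have rel: "w' \<in> ?R \<and> c w = c w'" if "braid_move\<^sup>*\<^sup>* w w'" "w \<in> ?R" for w w'
    using that by (induction rule: rtranclp_induct) (auto dest: braid_move_reduced_words move)
  \<comment> \<open>The colouring is constant along braid moves, so it factors through the braid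
    classes by way of chosen representatives.\<close>
  have "c ` ?R \<subseteq> (\<lambda>X. c (SOME x. x \<in> X)) ` braid_classes n (longest_perm n)"
  proof clarify
    fix w assume w: "w \<in> ?R"
    let ?X = "braid_rel n (longest_perm n) `` {w}"
    have "w \<in> ?X" using w by (auto simp: braid_rel_def)
    then have "(SOME x. x \<in> ?X) \<in> ?X" by (rule someI)
    then have eq: "c w = c (SOME x. x \<in> ?X)" using rel w by (auto simp: braid_rel_def)
    have "?X \<in> braid_classes n (longest_perm n)" unfolding braid_classes_def using w by (rule quotientI)
    with eq show "c w \<in> (\<lambda>X. c (SOME x. x \<in> X)) ` braid_classes n (longest_perm n)"
      by (rule image_eqI)
  qed
  moreover have "finite (braid_classes n (longest_perm n))"
    unfolding braid_classes_def quotient_def using finite_reduced_words by blast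
  ultimately have "card (c ` ?R) \<le> card (braid_classes n (longest_perm n))"
    by (meson card_image_le card_mono finite_imageI order_trans)
  then show ?thesis using c(2) cardF by linarith
qed

theorem theorem7p3:
  fixes n :: nat
  shows "real (card (braid_classes n (longest_perm n)))
           \<ge> 1 / 2 * real (card (reduced_words n (longest_perm n))) - 1"
proof -
  let ?N = "card (inversions n (longest_perm n))"
  let ?S = "\<Sum>a\<in>{1..n - 2}. real (nred (rev_perm3 n a))"
  have le: "real (card (reduced_words n (longest_perm n))) \<le>
      real (card (braid_classes n (longest_perm n))) + real (?N - 2) * ?S"
    using card_reduced_words_le[of n] by (simp flip: of_nat_sum of_nat_mult of_nat_add)
  show ?thesis
  proof (cases "3 \<le> n")
    case True
    have "2 * real ?N = real n * (real n - 1)"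
      using arg_cong[OF card_inversions_longest_perm[of n], of real] True by (simp add: of_nat_diff)
    \<comment> \<open>This makes the truncated difference \<open>?N - 2\<close> a genuine
      one.\<close>
    moreover have "3 * 2 \<le> real n * (real n - 1)" using True by (intro mult_mono) auto
    ultimately have "real (?N - 2) = real n * (real n - 1) / 2 - 2" by (simp add: of_nat_diff)
    then have "2 * (real (?N - 2) * ?S) = real (card (reduced_words n (longest_perm n)))"
      using sum_nred_rev_perm3[OF True] unfolding card_reduced_words by (simp only: mult.assoc)
    then show ?thesis using le by linarith
  next
    case False
    \<comment> \<open>No letters a and a+1 are both available, so there are no braid moves. The
      identity of \<open>sum_nred_rev_perm3\<close> fails here: its left side is 0, while there is
      one reduced word.\<close>
    then have "{1..n - 2} = {}" by auto
    then show ?thesis using le by simp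
  qed
qed

end
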